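(* Let $G=(V,E)$ be a finite simple graph with at least one edge, $k\in\{1,\dots,n\}$, let $\vec\phi_k$ be an eigenvector of problem (M) with eigenvalue $c_k$ (a critical point at level $c_k$), and let $r=\#\{j: c_j=c_k\}$ be the multiplicity of $c_k$. Then $S(\vec\phi_k)\le k+r-1$ and $S_0(\vec\phi_k)\le k+r-2$.
   Context: $V=\{1,\dots,n\}$, unit edge weights, $\mathrm{vol}(V)=\sum_id_i$, $I(\vec x)=\sum_{\{i,j\}\in E}|x_i-x_j|$. $\mathrm{Sgn}(t)=\{1\},[-1,1],\{-1\}$ for $t>0,t=0,t<0$; $(\Delta_1\vec x)_i=\{\sum_{j:\{i,j\}\in E}z_{ij}: z_{ij}\in\mathrm{Sgn}(x_i-x_j), z_{ij}=-z_{ji}\}$. Problem (M): $(\mu,\vec x)$ with $\vec x\ne\vec 0$ and $\Delta_1\vec x\cap\mu\,\mathrm{vol}(V)\,\partial\|\vec x\|_\infty\ne\emptyset$. With $X_\infty=\{\vec x:\|\vec x\|_\infty=1\}$, $c_k=\inf\{\max_{\vec x\in A}\frac{I(\vec x)}{\mathrm{vol}(V)\|\vec x\|_\infty}: A\subseteq X_\infty\text{ compact}, A=-A,\gamma(A)\ge k\}$, $\gamma$ the Krasnoselskii genus. $D_\pm(\vec x)=\{i:\pm x_i=\|\vec x\|_\infty\}$, $D_0(\vec x)=\{i:|x_i|<\|\vec x\|_\infty\}$. $S(\vec x)$ is the number of connected components of the subgraph induced by $D_+(\vec x)$ plus that of the subgraph induced by $D_-(\vec x)$; $S_0(\vec x)$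 is the number of connected components of the subgraph induced by $D_0(\vec x)$. *)

theory Defs
  imports "HOL-Analysis.Analysis"
begin

text \<open>
  The vertex set is an arbitrary finite type \<open>'n\<close>, with \<open>n = CARD('n)\<close>. A simple graph is a
  symmetric irreflexive relation \<open>E\<close>, so an undirected edge is represented by both of its
  orientations. Vectors live in \<open>real ^ 'n\<close>, and the library's \<open>infnorm\<close> is the maximum norm.
\<close>

definition simple_graph :: "'n rel \<Rightarrow> bool" where
  "simple_graph E \<longleftrightarrow> sym E \<and> irrefl E"

definition vertex_degree :: "'n rel \<Rightarrow> 'n \<Rightarrow> nat" where
  "vertex_degree E i = card {j. (i, j) \<in> E}"

definition vol :: "'n::finite rel \<Rightarrow> real" where
  "vol E = (\<Sum>i\<in>UNIV. real (vertex_degree E i))"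

text \<open>The factor 1/2 compensates for counting each undirected edge in both orientations.\<close>

definition total_variation :: "'n::finite rel \<Rightarrow> real ^ 'n \<Rightarrow> real" where
  "total_variation E x = (\<Sum>(i, j)\<in>E. \<bar>x $ i - x $ j\<bar>) / 2"

definition Sgn :: "real \<Rightarrow> real set" where
  "Sgn t = (if t > 0 then {1} else if t = 0 then {-1..1} else {-1})"

text \<open>
  One antisymmetric edge selection \<open>z\<close> serves all coordinates at once, so this is a set of vectors
  and in general not a product of coordinate sets.
\<close>

definition one_laplacian :: "'n::finite rel \<Rightarrow> real ^ 'n \<Rightarrow> (real ^ 'n) set" where
  "one_laplacian E x =
    {y. \<exists>z :: 'n \<Rightarrow> 'n \<Rightarrow> real.
          (\<forall>i j. (i, j) \<in> E \<longrightarrow> z i j \<in> Sgn (x $ i - x $ j) \<and> z i j = - z j i) \<and>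
          (\<forall>i. y $ i = (\<Sum>j | (i, j) \<in> E. z i j))}"

definition subdifferential :: "('a::real_inner \<Rightarrow> real) \<Rightarrow> 'a \<Rightarrow> 'a set" where
  "subdifferential f x = {u. \<forall>y. f y \<ge> f x + u \<bullet> (y - x)}"

definition eigenpair :: "'n::finite rel \<Rightarrow> real \<Rightarrow> real ^ 'n \<Rightarrow> bool" where
  "eigenpair E \<mu> x \<longleftrightarrow>
    x \<noteq> 0 \<and>
    one_laplacian E x \<inter> (\<lambda>u. (\<mu> * vol E) *\<^sub>R u) ` subdifferential infnorm x \<noteq> {}"

text \<open>
  The library's \<open>nsphere m\<close> is the unit sphere of an (m + 1)-dimensional space, so \<open>h\<close> is an odd
  continuous map into the unit sphere of a space of dimension \<open>Suc m\<close>. In \<open>enat\<close> the infimum of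
  the empty set is infinity.
\<close>

definition genus :: "'a::real_normed_vector set \<Rightarrow> enat" where
  "genus A =
    (if A = {} then 0
     else Inf {enat (Suc m) | m. \<exists>h. continuous_map (top_of_set A) (nsphere m) h \<and>
                                     (\<forall>x\<in>A. \<forall>i. h (- x) i = - h x i)})"

text \<open>
  The supremum is a maximum: for \<open>k \<ge> 1\<close> the admissible sets are nonempty, and they are compact
  subsets of the unit sphere of \<open>infnorm\<close>, where the quotient is continuous. Admissible sets exist
  exactly for \<open>k \<le> CARD('n)\<close>; the value of the infimum is meaningful only for
  \<open>k \<in> {1..CARD('n)}\<close>.
\<close>

definition minimax_value :: "'n::finite rel \<Rightarrow> nat \<Rightarrow> real" where
  "minimax_value E k =
    (INF A \<in> {A :: (real ^ 'n) set. A \<subseteq> {x. infnorm x = 1} \<and> compact A \<and>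
                 uminus ` A = A \<and> enat k \<le> genus A}.
       SUP x\<in>A. total_variation E x / (vol E * infnorm x))"

definition D_plus :: "real ^ 'n::finite \<Rightarrow> 'n set" where
  "D_plus x = {i. x $ i = infnorm x}"

definition D_minus :: "real ^ 'n::finite \<Rightarrow> 'n set" where
  "D_minus x = {i. - x $ i = infnorm x}"

definition D_zero :: "real ^ 'n::finite \<Rightarrow> 'n set" where
  "D_zero x = {i. \<bar>x $ i\<bar> < infnorm x}"

text \<open>Components of the induced subgraph on \<open>D\<close>: classes of reachability by paths inside \<open>D\<close>.\<close>

definition num_components :: "'n rel \<Rightarrow> 'n set \<Rightarrow> nat" where
  "num_components E D = card (D // (Restr E D)\<^sup>*)"

definition S_pm :: "'n::finite rel \<Rightarrow> real ^ 'n \<Rightarrow> nat" where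
  "S_pm E x = num_components E (D_plus x) + num_components E (D_minus x)"

definition S_zero :: "'n::finite rel \<Rightarrow> real ^ 'n \<Rightarrow> nat" where
  "S_zero E x = num_components E (D_zero x)"

definition multiplicity_at :: "'n::finite rel \<Rightarrow> nat \<Rightarrow> nat" where
  "multiplicity_at E k = card {j \<in> {1..CARD('n)}. minimax_value E j = minimax_value E k}"

end

theory Submission
  imports Defs "HOL-Homology.Homology"
begin

text \<open>
  If the inequality \<open>I x \<le> c\<^sub>k vol(V) \<parallel>x\<parallel>\<^sub>\<infinity>\<close> holds on a linear subspace of dimension \<open>d\<close>, then the unit
  sphere of that subspace has genus at least \<open>d\<close> by Borsuk--Ulam, so \<open>c\<^sub>j \<le> c\<^sub>k\<close> for all \<open>j \<le> d\<close>. As the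
  \<open>c\<^sub>j\<close> increase, all of \<open>c\<^sub>k, \<dots>, c\<^sub>d\<close> agree, whence \<open>d \<le> k + r - 1\<close>.

  Such subspaces are read off the eigenvector. Let \<open>\<sigma>\<close> be its sign pattern on \<open>D\<^sub>\<plusminus>\<close>, extended by zero.
  Pairing the eigenvalue equation with \<open>\<sigma>\<close> gives \<open>I \<sigma> = c\<^sub>k vol(V)\<close>; since \<open>I \<sigma>\<close> is the sum of the boundary
  sizes of the components of \<open>D\<^sub>\<plusminus>\<close>, their indicators span a subspace of the required kind. Pairing it
  with the indicator of a component of \<open>D\<^sub>0\<close> shows that this component sends as many edges to \<open>D\<^sub>+\<close> as to
  \<open>D\<^sub>-\<close>, and \<open>\<bar>s - t\<bar> + \<bar>s + t\<bar> = 2 max \<bar>s\<bar> \<bar>t\<bar>\<close> makes the span of \<open>\<sigma>\<close> and these indicators work too.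

  Borsuk--Ulam follows from the fact that an odd self-map of a sphere has odd Brouwer degree. The
  library relates the degree of an odd map preserving the equator to that of its restriction, so it
  suffices to deform an odd map, through odd maps, into one preserving the equator.
\<close>

section \<open>Coordinate spheres\<close>

text \<open>The carrier of \<open>nsphere n\<close> as a plain set, so that set-based continuity
  applies. All these spheres lie in one space and are nested, so restriction to an equator needs no
  embedding.\<close>

definition coordinate_sphere :: "nat \<Rightarrow> (nat \<Rightarrow> real) set" where
  "coordinate_sphere n = {x. (\<Sum>i\<le>n. (x i)\<^sup>2) = 1 \<and> (\<forall>i>n. x i = 0)}"

lemma nsphere_eq_top_of_set: "nsphere n = top_of_set (coordinate_sphere n)"
  by (simp add: nsphere coordinate_sphere_def euclidean_product_topology)

lemma topspace_nsphere_eq: "topspace (nsphere n) = coordinate_sphere n"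
  by (simp add: nsphere_eq_top_of_set)

lemma continuous_map_nsphere_iff:
  "continuous_map (nsphere m) (nsphere n) f \<longleftrightarrow>
    continuous_on (coordinate_sphere m) f \<and> f ` coordinate_sphere m \<subseteq> coordinate_sphere n"
  by (auto simp: nsphere_eq_top_of_set continuous_map_in_subtopology)

lemma uminus_mem_coordinate_sphere:
  "x \<in> coordinate_sphere n \<Longrightarrow> (\<lambda>i. - x i) \<in> coordinate_sphere n"
  by (simp add: coordinate_sphere_def)

lemma coordinate_sphere_mono: "m \<le> n \<Longrightarrow> coordinate_sphere m \<subseteq> coordinate_sphere n"
proof
  fix x assume "m \<le> n" and x: "x \<in> coordinate_sphere m"
  have "(\<Sum>i\<le>n. (x i)\<^sup>2) = (\<Sum>i\<le>m. (x i)\<^sup>2)"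
    using x \<open>m \<le> n\<close> by (intro sum.mono_neutral_right) (auto simp: coordinate_sphere_def)
  with x \<open>m \<le> n\<close> show "x \<in> coordinate_sphere n"
    by (auto simp: coordinate_sphere_def)
qed

lemma abs_coordinate_le_1:
  assumes "x \<in> coordinate_sphere n"
  shows "\<bar>x i\<bar> \<le> 1"
proof (cases "i \<le> n")
  case True
  then have "(x i)\<^sup>2 \<le> (\<Sum>i\<le>n. (x i)\<^sup>2)"
    by (intro member_le_sum) auto
  then show ?thesis
    using assms by (simp add: coordinate_sphere_def abs_square_le_1)
qed (use assms in \<open>auto simp: coordinate_sphere_def\<close>)

lemma continuous_on_coordinate [continuous_intros]:
  "continuous_on S (\<lambda>x::nat \<Rightarrow> real. x i)"
  by (rule continuous_on_subset[OF continuous_on_product_coordinates]) auto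

lemma compact_coordinate_sphere: "compact (coordinate_sphere n)"
proof -
  have "compactin (product_topology (\<lambda>_. euclideanreal) UNIV) (PiE UNIV (\<lambda>_::nat. {-1..1::real}))"
    unfolding compactin_PiE by simp
  then have "compact (PiE UNIV (\<lambda>_::nat. {-1..1::real}))"
    by (simp add: euclidean_product_topology)
  moreover have "coordinate_sphere n =
      PiE UNIV (\<lambda>_::nat. {-1..1::real}) \<inter> ({x. (\<Sum>i\<le>n. (x i)\<^sup>2) = 1} \<inter> (\<Inter>i\<in>{n<..}. {x. x i = 0}))"
    (is "_ = ?B \<inter> _")
  proof -
    have "coordinate_sphere n \<subseteq> ?B"
      using abs_coordinate_le_1 by (auto simp: PiE_iff abs_le_iff minus_le_iff)
    moreover have "coordinate_sphere n = {x. (\<Sum>i\<le>n. (x i)\<^sup>2) = 1} \<inter> (\<Inter>i\<in>{n<..}. {x. x i = 0})"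
      by (auto simp: coordinate_sphere_def)
    ultimately show ?thesis
      by blast
  qed
  moreover have "closed {x::nat\<Rightarrow>real. (\<Sum>i\<le>n. (x i)\<^sup>2) = 1}"
    by (intro closed_Collect_eq continuous_intros)
  moreover have "closed (\<Inter>i\<in>{n<..}. {x::nat\<Rightarrow>real. x i = 0})"
    by (intro closed_INT ballI closed_Collect_eq continuous_intros)
  ultimately show ?thesis
    by (simp add: compact_Int_closed closed_Int)
qed

section \<open>Radial projection and straight-line homotopies\<close>

definition normalized :: "nat \<Rightarrow> (nat \<Rightarrow> real) \<Rightarrow> nat \<Rightarrow> real" where
  "normalized n a = (\<lambda>i. if i \<le> n then a i / sqrt (\<Sum>j\<le>n. (a j)\<^sup>2) else 0)"

lemma normalized_mem:
  assumes "(\<Sum>j\<le>n. (a j)\<^sup>2) > 0"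
  shows "normalized n a \<in> coordinate_sphere n"
proof -
  have "(\<Sum>i\<le>n. (normalized n a i)\<^sup>2) = (\<Sum>i\<le>n. (a i)\<^sup>2 / (\<Sum>j\<le>n. (a j)\<^sup>2))"
    using assms by (intro sum.cong) (auto simp: normalized_def power_divide)
  also have "\<dots> = 1"
    unfolding sum_divide_distrib[symmetric] using assms by (intro divide_self) linarith
  finally show ?thesis
    by (simp add: coordinate_sphere_def normalized_def)
qed

lemma normalized_id: "x \<in> coordinate_sphere n \<Longrightarrow> normalized n x = x"
  by (auto simp: normalized_def coordinate_sphere_def)

lemma normalized_uminus: "normalized n (\<lambda>i. - a i) = (\<lambda>i. - normalized n a i)"
  by (auto simp: normalized_def)

lemma continuous_on_normalized:
  assumes "\<And>i. i \<le> n \<Longrightarrow> continuous_on S (\<lambda>x. f x i)"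
    and "\<And>x. x \<in> S \<Longrightarrow> (\<Sum>j\<le>n. (f x j)\<^sup>2) > 0"
  shows "continuous_on S (\<lambda>x. normalized n (f x))"
proof (rule continuous_on_coordinatewise_then_product)
  fix i
  have "sqrt (\<Sum>j\<le>n. (f x j)\<^sup>2) \<noteq> 0" if "x \<in> S" for x
    using assms(2)[OF that] by simp
  then show "continuous_on S (\<lambda>x. normalized n (f x) i)"
    unfolding normalized_def using assms(1)
    by (cases "i \<le> n") (auto intro!: continuous_intros)
qed

text \<open>A positive inner product keeps the segment from \<open>f x\<close> to \<open>g x\<close>
  away from the origin, so the straight-line homotopy can be projected to the sphere.\<close>

lemma homotopic_normalized:
  assumes cf: "\<And>i. i \<le> n \<Longrightarrow> continuous_on (coordinate_sphere n) (\<lambda>x. f x i)"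
    and cg: "\<And>i. i \<le> n \<Longrightarrow> continuous_on (coordinate_sphere n) (\<lambda>x. g x i)"
    and pos: "\<And>x. x \<in> coordinate_sphere n \<Longrightarrow> (\<Sum>i\<le>n. f x i * g x i) > 0"
  shows "homotopic_with (\<lambda>_. True) (nsphere n) (nsphere n)
           (\<lambda>x. normalized n (f x)) (\<lambda>x. normalized n (g x))"
proof -
  define H where "H = (\<lambda>p::real \<times> (nat \<Rightarrow> real). \<lambda>i. (1 - fst p) * f (snd p) i + fst p * g (snd p) i)"
  let ?S = "{0..1} \<times> coordinate_sphere n"
  have pos': "(\<Sum>j\<le>n. (H p j)\<^sup>2) > 0" if pS: "p \<in> ?S" for p
  proof -
    obtain t x where p: "p = (t, x)" and t: "0 \<le> t" "t \<le> 1" and x: "x \<in> coordinate_sphere n"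
      using pS by (cases p) auto
    have "(\<Sum>j\<le>n. (H p j)\<^sup>2) = (\<Sum>j\<le>n. (1-t)\<^sup>2 * (f x j)\<^sup>2 + 2 * t * (1-t) * (f x j * g x j) + t\<^sup>2 * (g x j)\<^sup>2)"
      by (intro sum.cong refl) (simp add: H_def p power2_eq_square algebra_simps)
    also have "\<dots> = (1-t)\<^sup>2 * (\<Sum>j\<le>n. (f x j)\<^sup>2) + 2 * t * (1-t) * (\<Sum>j\<le>n. f x j * g x j) + t\<^sup>2 * (\<Sum>j\<le>n. (g x j)\<^sup>2)"
      by (simp add: sum.distrib sum_distrib_left)
    finally have eq: "(\<Sum>j\<le>n. (H p j)\<^sup>2) = \<dots>" .
    obtain j where "j \<le> n" "f x j * g x j \<noteq> 0"
      using pos[OF x] by (metis (no_types, lifting) atMost_iff less_irrefl sum.neutral)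
    then have "(\<Sum>j\<le>n. (f x j)\<^sup>2) \<noteq> 0" "(\<Sum>j\<le>n. (g x j)\<^sup>2) \<noteq> 0"
      by (auto simp: sum_nonneg_eq_0_iff)
    then have fg: "(\<Sum>j\<le>n. (f x j)\<^sup>2) > 0" "(\<Sum>j\<le>n. (g x j)\<^sup>2) > 0"
      by (simp_all add: sum_nonneg order_less_le)
    consider "t = 0" | "t = 1" | "0 < t" "t < 1" using t by linarith
    then show ?thesis
    proof cases
      case 3
      then have "2 * t * (1-t) * (\<Sum>j\<le>n. f x j * g x j) > 0" using pos[OF x] by simp
      then show ?thesis unfolding eq using fg
        by (intro add_nonneg_pos add_pos_pos mult_nonneg_nonneg mult_pos_pos) (use 3 in auto)
    qed (use fg eq in auto)
  qed
  have cH: "continuous_on ?S (\<lambda>p. H p i)" if "i \<le> n" for i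
  proof -
    have "continuous_on ?S (\<lambda>p. f (snd p) i)"
      by (rule continuous_on_compose2[OF cf[OF that] continuous_on_snd[OF continuous_on_id]]) auto
    moreover have "continuous_on ?S (\<lambda>p. g (snd p) i)"
      by (rule continuous_on_compose2[OF cg[OF that] continuous_on_snd[OF continuous_on_id]]) auto
    ultimately show ?thesis
      unfolding H_def by (intro continuous_intros)
  qed
  have "continuous_on ?S (\<lambda>p. normalized n (H p))"
    by (rule continuous_on_normalized) (use cH pos' in auto)
  moreover have "normalized n (H p) \<in> coordinate_sphere n" if "p \<in> ?S" for p
    by (rule normalized_mem[OF pos'[OF that]])
  ultimately have "continuous_map (prod_topology (top_of_set {0..1}) (nsphere n)) (nsphere n) (\<lambda>p. normalized n (H p))"
    unfolding nsphere_eq_top_of_set prod_topology_subtopology_eu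
    by (auto simp: continuous_map_in_subtopology)
  then show ?thesis
    unfolding homotopic_with_def
    by (intro exI[of _ "\<lambda>p. normalized n (H p)"]) (auto simp: H_def)
qed

section \<open>Odd perturbations without common zeros\<close>

text \<open>
  Functions of \<open>nat \<Rightarrow> real\<close> that are smooth in the first \<open>n\<close> coordinates once the others vanish, with
  \<open>e\<close> naming those coordinates in the vector type \<open>real ^ 'a\<close>.
\<close>

definition smooth_coordinate_functions :: "nat \<Rightarrow> (nat \<Rightarrow> 'a::finite) \<Rightarrow> ((nat \<Rightarrow> real) \<Rightarrow> real) set" where
  "smooth_coordinate_functions n e =
    {g. continuous_on UNIV g \<and>
        (\<lambda>w::real^'a. g (\<lambda>i. if i < n then w $ e i else 0)) differentiable_on UNIV}"

lemma smooth_coordinate_functions_coordinate: "(\<lambda>x. x i) \<in> smooth_coordinate_functions n (e :: nat \<Rightarrow> 'a::finite)"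
proof -
  have "(\<lambda>w::real^'a. if i < n then w $ e i else 0) differentiable_on UNIV"
    by (cases "i < n") (auto intro!: bounded_linear_imp_differentiable_on bounded_linear_vec_nth)
  then show ?thesis
    by (simp add: smooth_coordinate_functions_def continuous_on_coordinate)
qed

lemma smooth_coordinate_functions_add:
  "\<lbrakk>f \<in> smooth_coordinate_functions n e; g \<in> smooth_coordinate_functions n e\<rbrakk>
    \<Longrightarrow> (\<lambda>x. f x + g x) \<in> smooth_coordinate_functions n e"
  by (auto simp: smooth_coordinate_functions_def intro!: continuous_intros differentiable_on_add)

lemma smooth_coordinate_functions_mult:
  "\<lbrakk>f \<in> smooth_coordinate_functions n e; g \<in> smooth_coordinate_functions n e\<rbrakk>
    \<Longrightarrow> (\<lambda>x. f x * g x) \<in> smooth_coordinate_functions n e"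
  by (auto simp: smooth_coordinate_functions_def intro!: continuous_intros differentiable_on_mult)

lemma smooth_coordinate_functions_const: "(\<lambda>_. c) \<in> smooth_coordinate_functions n e"
  by (auto simp: smooth_coordinate_functions_def)

lemma smooth_coordinate_functions_uminus:
  fixes e :: "nat \<Rightarrow> 'a::finite"
  assumes "g \<in> smooth_coordinate_functions n e"
  shows "(\<lambda>x. g (\<lambda>i. - x i)) \<in> smooth_coordinate_functions n e"
proof -
  have eq: "(\<lambda>i. if i < n then (- w) $ e i else 0) = (\<lambda>i. - (if i < n then w $ e i else 0))" for w :: "real^'a"
    by (rule ext) simp
  have neg: "continuous_on UNIV (\<lambda>x::nat \<Rightarrow> real. \<lambda>i. - x i)"
    by (intro continuous_on_coordinatewise_then_product continuous_on_minus continuous_on_coordinate)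
  have "continuous_on UNIV g"
    using assms by (simp add: smooth_coordinate_functions_def)
  from continuous_on_compose2[OF this neg] have cont: "continuous_on UNIV (\<lambda>x. g (\<lambda>i. - x i))"
    by simp
  have diff: "(\<lambda>w::real^'a. g (\<lambda>i. if i < n then (- w) $ e i else 0)) differentiable_on UNIV"
  proof (rule differentiable_on_compose[where f = "\<lambda>w. g (\<lambda>i. if i < n then w $ e i else 0)"])
    show "uminus differentiable_on (UNIV :: (real^'a) set)"
      by (rule bounded_linear_imp_differentiable_on[OF bounded_linear_minus[OF bounded_linear_ident]])
    show "(\<lambda>w. g (\<lambda>i. if i < n then w $ e i else 0)) differentiable_on range (uminus :: real^'a \<Rightarrow> _)"
      by (rule differentiable_on_subset[OF _ subset_UNIV]) (use assms in \<open>simp add: smooth_coordinate_functions_def\<close>)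
  qed
  show ?thesis
    unfolding smooth_coordinate_functions_def by (intro CollectI conjI cont diff[unfolded eq])
qed

text \<open>The odd part of a Stone--Weierstrass approximation works: averaging over
  \<open>x\<close> and its antipode preserves the error bound because \<open>f\<close> is
  odd.\<close>

lemma odd_smooth_approximation:
  assumes f: "continuous_on (coordinate_sphere n) f"
    and odd: "\<And>x. x \<in> coordinate_sphere n \<Longrightarrow> f (\<lambda>i. - x i) = - f x"
    and "\<epsilon> > 0"
  obtains g where "g \<in> smooth_coordinate_functions m e" "\<And>x. g (\<lambda>i. - x i) = - g x"
    "\<And>x. x \<in> coordinate_sphere n \<Longrightarrow> \<bar>g x - f x\<bar> < \<epsilon>"
proof -
  interpret function_ring_on "smooth_coordinate_functions m e" "coordinate_sphere n"
  proof
    show "\<exists>f\<in>smooth_coordinate_functions m e. f x \<noteq> f y" if "x \<noteq> y" for x y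
      using that smooth_coordinate_functions_coordinate by (metis ext)
  qed (auto simp: compact_coordinate_sphere intro: smooth_coordinate_functions_add
         smooth_coordinate_functions_mult smooth_coordinate_functions_const,
       auto simp: smooth_coordinate_functions_def intro: continuous_on_subset)
  obtain h where h: "h \<in> smooth_coordinate_functions m e"
    and happ: "\<And>x. x \<in> coordinate_sphere n \<Longrightarrow> \<bar>f x - h x\<bar> < \<epsilon>"
    using Stone_Weierstrass_basic[OF f \<open>\<epsilon> > 0\<close>] by blast
  define g where "g = (\<lambda>x. 1/2 * (h x + - 1 * h (\<lambda>i. - x i)))"
  have "g \<in> smooth_coordinate_functions m e"
    unfolding g_def using h
    by (intro smooth_coordinate_functions_mult smooth_coordinate_functions_add
        smooth_coordinate_functions_const smooth_coordinate_functions_uminus)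
  moreover have "g (\<lambda>i. - x i) = - g x" for x
    by (simp add: g_def field_simps)
  moreover have "\<bar>g x - f x\<bar> < \<epsilon>" if "x \<in> coordinate_sphere n" for x
  proof -
    have "\<bar>1/2 * (b + - 1 * d) - a\<bar> < \<epsilon>" if "\<bar>a - b\<bar> < \<epsilon>" "\<bar>- a - d\<bar> < \<epsilon>" for a b d
      using that by argo
    then show ?thesis
      using happ[OF that] happ[OF uminus_mem_coordinate_sphere[OF that]]
      unfolding g_def odd[OF that] by blast
  qed
  ultimately show ?thesis
    using that by blast
qed

text \<open>The cylinder lies in the frontier of the convex solid cylinder, and frontiers of convex
  sets are null.\<close>

lemma negligible_cylinder:
  assumes "I \<noteq> {}"
  shows "negligible {w::real^'a::finite. (\<Sum>i\<in>I. (w $ i)\<^sup>2) = 1}"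
proof -
  let ?B = "{w::real^'a. (\<Sum>i\<in>I. (w $ i)\<^sup>2) \<le> 1}"
  have "convex ?B"
  proof (rule convexI)
    fix x y :: "real^'a" and u v :: real
    assume x: "x \<in> ?B" and y: "y \<in> ?B" and uv: "0 \<le> u" "0 \<le> v" "u + v = 1"
    have *: "(u * a + v * b)\<^sup>2 \<le> u * a\<^sup>2 + v * b\<^sup>2" for a b
    proof -
      have "u * a\<^sup>2 + v * b\<^sup>2 - (u * a + v * b)\<^sup>2 = u * v * (a - b)\<^sup>2"
      proof -
        have v: "v = 1 - u" using uv(3) by linarith
        show ?thesis unfolding v by (simp add: power2_eq_square algebra_simps)
      qed
      moreover have "\<dots> \<ge> 0"
        using uv by simp
      ultimately show ?thesis by linarith
    qed
    have "(\<Sum>i\<in>I. ((u *\<^sub>R x + v *\<^sub>R y) $ i)\<^sup>2) \<le> (\<Sum>i\<in>I. u * (x $ i)\<^sup>2 + v * (y $ i)\<^sup>2)"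
      by (intro sum_mono) (simp add: *)
    also have "\<dots> = u * (\<Sum>i\<in>I. (x $ i)\<^sup>2) + v * (\<Sum>i\<in>I. (y $ i)\<^sup>2)"
      by (simp add: sum.distrib sum_distrib_left)
    also have "\<dots> \<le> u * 1 + v * 1"
      using x y uv by (intro add_mono mult_left_mono) auto
    finally show "u *\<^sub>R x + v *\<^sub>R y \<in> ?B"
      using uv by simp
  qed
  then have "negligible (frontier ?B)"
    by (rule negligible_convex_frontier)
  moreover have "{w::real^'a. (\<Sum>i\<in>I. (w $ i)\<^sup>2) = 1} \<subseteq> frontier ?B"
  proof
    fix w :: "real^'a" assume w: "w \<in> {w. (\<Sum>i\<in>I. (w $ i)\<^sup>2) = 1}"
    have "w \<notin> interior ?B"
    proof
      assume "w \<in> interior ?B"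
      then obtain \<delta> where \<delta>: "\<delta> > 0" "ball w \<delta> \<subseteq> ?B"
        by (meson mem_interior)
      \<comment> \<open>Scaling \<open>w\<close> by \<open>1 + s\<close> moves it by less than
        \<delta> but pushes the sum of squares above 1, so \<open>w\<close> is not interior.\<close>
      define s where "s = \<delta> / (2 * (norm w + 1))"
      have "s > 0"
        using \<delta>(1) by (simp add: s_def add_nonneg_pos)
      moreover have "s * (norm w + 1) = \<delta> / 2"
      proof -
        have "\<delta> / (2 * c) * c = \<delta> / 2" if "c > 0" for c
          using that by simp
        then show ?thesis
          unfolding s_def by (simp only: add_nonneg_pos norm_ge_zero zero_less_one)
      qed
      ultimately have s: "s > 0" "norm (s *\<^sub>R w) < \<delta>"
        using \<delta>(1) by (simp_all add: algebra_simps)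
      have "w - (1 + s) *\<^sub>R w = - (s *\<^sub>R w)"
        by (simp add: algebra_simps)
      then have "(1 + s) *\<^sub>R w \<in> ball w \<delta>"
        using s(2) by (simp only: mem_ball dist_norm norm_minus_cancel)
      with \<delta>(2) have "(1 + s) *\<^sub>R w \<in> ?B"
        by blast
      moreover have "(\<Sum>i\<in>I. (((1 + s) *\<^sub>R w) $ i)\<^sup>2) = (1 + s)\<^sup>2 * (\<Sum>i\<in>I. (w $ i)\<^sup>2)"
        by (simp add: power_mult_distrib sum_distrib_left)
      ultimately have "(1 + s)\<^sup>2 \<le> 1"
        using w by simp
      moreover have "(1 + s)\<^sup>2 > 1"
        using s by (simp add: one_less_power)
      ultimately show False
        by simp
    qed
    then show "w \<in> frontier ?B"
      using w closure_subset[of ?B] by (auto simp: frontier_def)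
  qed
  ultimately show ?thesis
    by (rule negligible_subset)
qed

text \<open>
  The type \<open>'a\<close> only supplies a Euclidean space with at least \<open>n\<close> coordinates, in which Lebesgue measure
  is available. Starting from an odd smooth approximation, add \<open>x m * v\<close> for each coordinate \<open>m\<close> in
  turn: the vectors \<open>v\<close> that create a zero with \<open>x m \<noteq> 0\<close> lie in the image of the (null) sphere under
  the smooth map \<open>x \<mapsto> - F x / x m\<close>, while points with \<open>x m = 0\<close> are unaffected. To stay in one space,
  the sphere is replaced by the cylinder over it and the spare coordinates are carried along.
\<close>

lemma odd_perturbation_without_common_zero:
  fixes f :: "nat \<Rightarrow> (nat \<Rightarrow> real) \<Rightarrow> real"
  assumes n: "0 < n" "n \<le> CARD('a::finite)"
    and cont: "\<And>j. j < n \<Longrightarrow> continuous_on (coordinate_sphere n) (f j)"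
    and odd: "\<And>j x. \<lbrakk>j < n; x \<in> coordinate_sphere n\<rbrakk> \<Longrightarrow> f j (\<lambda>i. - x i) = - f j x"
    and "\<epsilon> > 0"
  obtains F where "\<And>j. j < n \<Longrightarrow> continuous_on UNIV (F j)"
    "\<And>j x. j < n \<Longrightarrow> F j (\<lambda>i. - x i) = - F j x"
    "\<And>j x. \<lbrakk>j < n; x \<in> coordinate_sphere n\<rbrakk> \<Longrightarrow> \<bar>F j x - f j x\<bar> < \<epsilon>"
    "\<And>x. x \<in> coordinate_sphere (n - 1) \<Longrightarrow> \<exists>j<n. F j x \<noteq> 0"
proof -
  obtain e :: "nat \<Rightarrow> 'a" where e: "bij_betw e {0..<CARD('a)} UNIV"
    using ex_bij_betw_nat_finite[of "UNIV :: 'a set"] by auto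
  then have inj: "inj_on e {..<n}"
    using n by (auto simp: bij_betw_def intro: inj_on_subset)
  define N where "N = e ` {..<n}"
  define idx where "idx = inv_into {..<n} e"
  have idx_e [simp]: "idx (e i) = i" if "i < n" for i
    using that inj by (simp add: idx_def)
  have e_N [simp]: "e i \<in> N" if "i < n" for i
    using that by (simp add: N_def)
  define T where "T = (\<lambda>w::real^'a. \<lambda>i. if i < n then w $ e i else 0)"
  let ?R = "smooth_coordinate_functions n e"
  \<comment> \<open>Induction on \<open>m\<close>, excluding common zeros at points with some
    nonzero coordinate of index below \<open>m\<close>. The tolerance is universally quantified
    because each step spends half of it.\<close>
  have "\<exists>F. (\<forall>j<n. F j \<in> ?R \<and> (\<forall>x. F j (\<lambda>i. - x i) = - F j x) \<and>
               (\<forall>x\<in>coordinate_sphere n. \<bar>F j x - f j x\<bar> < \<epsilon>)) \<and>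
            (\<forall>x\<in>coordinate_sphere (n - 1). (\<exists>i<m. x i \<noteq> 0) \<longrightarrow> (\<exists>j<n. F j x \<noteq> 0))"
    if "m \<le> n" "\<epsilon> > 0" for m \<epsilon>
    using that
  proof (induction m arbitrary: \<epsilon>)
    case 0
    have "\<exists>g. g \<in> ?R \<and> (\<forall>x. g (\<lambda>i. - x i) = - g x) \<and> (\<forall>x\<in>coordinate_sphere n. \<bar>g x - f j x\<bar> < \<epsilon>)"
      if "j < n" for j
      using odd_smooth_approximation[OF cont[OF that] odd[OF that] \<open>\<epsilon> > 0\<close>] by metis
    then have "\<forall>j. \<exists>g. j < n \<longrightarrow> g \<in> ?R \<and> (\<forall>x. g (\<lambda>i. - x i) = - g x) \<and>
        (\<forall>x\<in>coordinate_sphere n. \<bar>g x - f j x\<bar> < \<epsilon>)"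
      by blast
    from choice[OF this] show ?case
      by simp
  next
    case (Suc m)
    then have m: "m < n" and "\<epsilon>/2 > 0" by auto
    obtain F where
      F': "\<forall>j<n. F j \<in> ?R \<and> (\<forall>x. F j (\<lambda>i. - x i) = - F j x) \<and>
             (\<forall>x\<in>coordinate_sphere n. \<bar>F j x - f j x\<bar> < \<epsilon>/2)"
      and nz: "\<forall>x\<in>coordinate_sphere (n - 1). (\<exists>i<m. x i \<noteq> 0) \<longrightarrow> (\<exists>j<n. F j x \<noteq> 0)"
      using Suc.IH[OF less_imp_le[OF m] \<open>\<epsilon>/2 > 0\<close>] by blast
    have F: "F j \<in> ?R" "F j (\<lambda>i. - x i) = - F j x" if "j < n" for j x
      using F' that by blast+
    have app: "\<bar>F j x - f j x\<bar> < \<epsilon>/2" if "j < n" "x \<in> coordinate_sphere n" for j x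
      using F' that by blast
    define D where "D = {w::real^'a. (\<Sum>a\<in>N. (w $ a)\<^sup>2) = 1} \<inter> {w. w $ e m \<noteq> 0}"
    define \<Phi> where "\<Phi> = (\<lambda>w::real^'a. \<chi> a. if a \<in> N then - F (idx a) (T w) / w $ e m else w $ a)"
    have "negligible D"
      unfolding D_def using n by (intro negligible_subset[OF negligible_cylinder[of N]]) (auto simp: N_def)
    moreover have "\<Phi> differentiable_on D"
      unfolding differentiable_on_def
    proof
      fix w assume w: "w \<in> D"
      have vec: "(\<lambda>w::real^'a. w $ a) differentiable (at w within D)" for a
        by (intro bounded_linear_imp_differentiable bounded_linear_vec_nth)
      have FT: "(\<lambda>w. F j (T w)) differentiable (at w within D)" if "j < n" for j
        using F(1)[OF that] unfolding smooth_coordinate_functions_def differentiable_on_def T_def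
        by (auto intro: differentiable_at_withinI)
      have "(\<lambda>w. \<Phi> w $ a) differentiable (at w within D)" for a
      proof (cases "a \<in> N")
        case True
        then obtain j where j: "j < n" "a = e j"
          by (auto simp: N_def)
        have "(\<lambda>w. - F j (T w) / w $ e m) differentiable (at w within D)"
          using w by (intro differentiable_divide differentiable_minus FT j vec) (auto simp: D_def)
        then show ?thesis
          by (simp add: \<Phi>_def j)
      qed (simp add: \<Phi>_def vec)
      then show "\<Phi> differentiable (at w within D)"
        by (subst differentiable_componentwise_within) (auto simp: Basis_vec_def inner_axis)
    qed
    ultimately have "negligible (\<Phi> ` D)"
      by (intro negligible_differentiable_image_negligible) auto
    moreover have "\<not> negligible (ball (0::real^'a) (\<epsilon>/2))"
      using \<open>\<epsilon>/2 > 0\<close> by (intro open_not_negligible) auto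
    ultimately have "\<not> ball 0 (\<epsilon>/2) \<subseteq> \<Phi> ` D"
      using negligible_subset by blast
    then obtain u where u: "norm u < \<epsilon>/2" "u \<notin> \<Phi> ` D"
      by (meson mem_ball_0 subsetI)
    define F' where "F' = (\<lambda>j x. F j x + x m * u $ e j)"
    show ?case
    proof (intro exI[of _ F'] conjI allI ballI impI)
      fix j assume j: "j < n"
      show "F' j \<in> ?R"
        unfolding F'_def using F(1)[OF j]
        by (intro smooth_coordinate_functions_mult smooth_coordinate_functions_add
            smooth_coordinate_functions_const smooth_coordinate_functions_coordinate)
      show "F' j (\<lambda>i. - x i) = - F' j x" for x
        by (simp add: F'_def F(2)[OF j])
      fix x assume x: "x \<in> coordinate_sphere n"
      have "\<bar>x m * u $ e j\<bar> \<le> 1 * \<bar>u $ e j\<bar>"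
        unfolding abs_mult using abs_coordinate_le_1[OF x] by (intro mult_right_mono) auto
      then show "\<bar>F' j x - f j x\<bar> < \<epsilon>"
        using app[OF j x] u(1) component_le_norm_cart[of u "e j"] unfolding F'_def by linarith
    next
      fix x assume x: "x \<in> coordinate_sphere (n - 1)" and ex: "\<exists>i<Suc m. x i \<noteq> 0"
      show "\<exists>j<n. F' j x \<noteq> 0"
      proof (cases "x m = 0")
        case True
        then have "\<exists>i<m. x i \<noteq> 0"
          using ex by (metis less_Suc_eq)
        with nz x True show ?thesis
          by (simp add: F'_def)
      next
        case False
        show ?thesis
        proof (rule ccontr)
          assume "\<not> ?thesis"
          then have zero: "F j x = - (x m * u $ e j)" if "j < n" for j
            using that by (simp add: F'_def eq_neg_iff_add_eq_0)
          \<comment> \<open>At a common zero, the point with the coordinates of \<open>x\<close> on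
            \<open>N\<close> and those of \<open>u\<close> elsewhere lies in \<open>D\<close> and is
            sent to \<open>u\<close>, contrary to the choice of \<open>u\<close>.\<close>
          define w where "w = (\<chi> a. if a \<in> N then x (idx a) else u $ a)"
          have x0: "x i = 0" if "\<not> i < n" for i
            using x that n by (simp add: coordinate_sphere_def)
          have Tw: "T w = x"
            by (rule ext) (simp add: T_def w_def x0)
          have "(\<Sum>a\<in>N. (w $ a)\<^sup>2) = (\<Sum>i<n. (x i)\<^sup>2)"
            unfolding N_def sum.reindex[OF inj] by (intro sum.cong) (simp_all add: w_def)
          also have "{..<n} = {..n - 1}"
            using n by auto
          finally have "w \<in> D"
            using x False m by (simp add: D_def coordinate_sphere_def) (simp add: w_def)
          moreover have "\<Phi> w = u"
            unfolding vec_eq_iff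
          proof
            fix a
            show "\<Phi> w $ a = u $ a"
            proof (cases "a \<in> N")
              case True
              then obtain j where "j < n" "a = e j"
                by (auto simp: N_def)
              then show ?thesis
                using False m by (simp add: \<Phi>_def Tw zero) (simp add: w_def)
            qed (simp add: \<Phi>_def w_def)
          qed
          ultimately show False
            using u(2) by blast
        qed
      qed
    qed
  qed
  from this[OF order_refl \<open>\<epsilon> > 0\<close>] obtain F where
    F: "\<forall>j<n. F j \<in> ?R \<and> (\<forall>x. F j (\<lambda>i. - x i) = - F j x) \<and>
          (\<forall>x\<in>coordinate_sphere n. \<bar>F j x - f j x\<bar> < \<epsilon>)"
    and nz: "\<forall>x\<in>coordinate_sphere (n - 1). (\<exists>i<n. x i \<noteq> 0) \<longrightarrow> (\<exists>j<n. F j x \<noteq> 0)"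
    by blast
  show ?thesis
  proof (rule that)
    show "continuous_on UNIV (F j)" if "j < n" for j
      using F that by (simp add: smooth_coordinate_functions_def)
    show "\<exists>j<n. F j x \<noteq> 0" if x: "x \<in> coordinate_sphere (n - 1)" for x
    proof -
      have "\<exists>i\<le>n - 1. x i \<noteq> 0"
      proof (rule ccontr)
        assume "\<not> ?thesis"
        then have "(\<Sum>i\<le>n - 1. (x i)\<^sup>2) = 0"
          by simp
        with x show False
          by (simp add: coordinate_sphere_def)
      qed
      then obtain i where "i \<le> n - 1" and i: "x i \<noteq> 0"
        by blast
      then have "i < n"
        using n by linarith
      with i have "\<exists>i<n. x i \<noteq> 0"
        by blast
      with nz x show ?thesis
        by blast
    qed
  qed (use F in auto)
qed

section \<open>Degrees of odd maps\<close>

text \<open>This sphere is a pair of antipodal points, so an odd self-map is the identity or the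
  reflection, of degree 1 or -1.\<close>

lemma odd_degree_nsphere_0:
  assumes f: "f ` coordinate_sphere 0 \<subseteq> coordinate_sphere 0"
    and odd: "\<And>x. x \<in> coordinate_sphere 0 \<Longrightarrow> f (\<lambda>i. - x i) = (\<lambda>i. - f x i)"
  shows "odd (Brouwer_degree2 0 f)"
proof -
  define p where "p = (\<lambda>i::nat. if i = 0 then 1 else 0::real)"
  have sphere: "x = p \<or> x = (\<lambda>i. - p i)" if "x \<in> coordinate_sphere 0" for x
    using that by (auto simp: coordinate_sphere_def p_def power2_eq_1_iff)
  have p: "p \<in> coordinate_sphere 0"
    by (simp add: coordinate_sphere_def p_def)
  then have "f p \<in> coordinate_sphere 0"
    using f by blast
  then consider "f p = p" | "f p = (\<lambda>i. - p i)"
    using sphere by blast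
  then show ?thesis
  proof cases
    case 1
    then have "f x = id x" if "x \<in> coordinate_sphere 0" for x
      using sphere[OF that] odd[OF p] by auto
    then have "Brouwer_degree2 0 f = Brouwer_degree2 0 id"
      by (intro Brouwer_degree2_eq) (simp add: topspace_nsphere_eq)
    then show ?thesis
      by simp
  next
    case 2
    let ?r = "\<lambda>(x::nat \<Rightarrow> real) i. if i = 0 then - x i else x i"
    have "?r p = (\<lambda>i. - p i)" "?r (\<lambda>i. - p i) = p"
      by (auto simp: p_def)
    then have "f x = ?r x" if "x \<in> coordinate_sphere 0" for x
      using sphere[OF that] odd[OF p] 2 by auto
    then have "Brouwer_degree2 0 f = Brouwer_degree2 0 ?r"
      by (intro Brouwer_degree2_eq) (simp add: topspace_nsphere_eq)
    then show ?thesis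
      by (simp add: Brouwer_degree2_reflection)
  qed
qed

text \<open>
  Perturb the first \<open>n\<close> components so that they have no common zero on the equator \<open>x n = 0\<close>, then
  damp the last component by \<open>\<bar>x n\<bar>\<close>; every intermediate map has positive inner product with its
  predecessor, so normalization never divides by zero.
\<close>

lemma odd_map_homotopic_equator_preserving:
  assumes n: "0 < n" "n \<le> CARD('a::finite)"
    and f: "continuous_map (nsphere n) (nsphere n) f"
    and odd: "\<And>x. x \<in> coordinate_sphere n \<Longrightarrow> f (\<lambda>i. - x i) = (\<lambda>i. - f x i)"
  obtains g where "homotopic_with (\<lambda>_. True) (nsphere n) (nsphere n) f g"
    "\<And>x. x \<in> coordinate_sphere n \<Longrightarrow> g (\<lambda>i. - x i) = (\<lambda>i. - g x i)"
    "g ` coordinate_sphere (n - 1) \<subseteq> coordinate_sphere (n - 1)"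
proof -
  have fim: "f x \<in> coordinate_sphere n" if "x \<in> coordinate_sphere n" for x
    using f that unfolding continuous_map_nsphere_iff by blast
  have "continuous_on (coordinate_sphere n) f"
    using f by (simp add: continuous_map_nsphere_iff)
  then have cf: "continuous_on (coordinate_sphere n) (\<lambda>x. f x i)" for i
    by (rule continuous_on_product_then_coordinatewise)
  \<comment> \<open>The perturbation lowers the inner product of \<open>f x\<close> with itself,
    which is 1, by at most \<open>real n * \<epsilon>\<close>; this choice keeps the result
    positive.\<close>
  define \<epsilon> where "\<epsilon> = 1 / (real n + 1)"
  have \<epsilon>: "\<epsilon> > 0" "real n * \<epsilon> < 1"
    by (simp_all add: \<epsilon>_def field_simps)
  have odd': "f (\<lambda>i. - x i) j = - f x j" if "x \<in> coordinate_sphere n" for x j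
    using odd[OF that] by simp
  obtain F where cF: "\<And>j. j < n \<Longrightarrow> continuous_on UNIV (F j)"
    and oddF: "\<And>j x. j < n \<Longrightarrow> F j (\<lambda>i. - x i) = - F j x"
    and app: "\<And>j x. \<lbrakk>j < n; x \<in> coordinate_sphere n\<rbrakk> \<Longrightarrow> \<bar>F j x - f x j\<bar> < \<epsilon>"
    and nz: "\<And>x. x \<in> coordinate_sphere (n - 1) \<Longrightarrow> \<exists>j<n. F j x \<noteq> 0"
  proof (rule odd_perturbation_without_common_zero[where f = "\<lambda>j x. f x j", OF n cf odd' \<epsilon>(1)])
    fix F
    assume "\<And>j. j < n \<Longrightarrow> continuous_on UNIV (F j)"
      "\<And>j x. j < n \<Longrightarrow> F j (\<lambda>i. - x i) = - F j x"
      "\<And>j x. \<lbrakk>j < n; x \<in> coordinate_sphere n\<rbrakk> \<Longrightarrow> \<bar>F j x - f x j\<bar> < \<epsilon>"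
      "\<And>x. x \<in> coordinate_sphere (n - 1) \<Longrightarrow> \<exists>j<n. F j x \<noteq> 0"
    then show thesis by (rule that)
  qed
  define A where "A = (\<lambda>x i. if i < n then F i x else f x i)"
  define B where "B = (\<lambda>x i. if i < n then F i x else \<bar>x n\<bar> * f x i)"
  have cF': "continuous_on (coordinate_sphere n) (F j)" if "j < n" for j
    using cF[OF that] by (rule continuous_on_subset) simp
  have cA: "continuous_on (coordinate_sphere n) (\<lambda>x. A x i)" for i
    by (cases "i < n") (simp_all add: A_def cF' cf)
  have cB: "continuous_on (coordinate_sphere n) (\<lambda>x. B x i)" for i
    by (cases "i < n")
       (auto simp: B_def intro!: cF' cf continuous_on_mult continuous_on_rabs continuous_on_coordinate)
  have split: "(\<Sum>i\<le>n. h i) = (\<Sum>i<n. h i) + h n" for h :: "nat \<Rightarrow> real"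
    by (simp add: lessThan_Suc_atMost[symmetric])
  have fA: "(\<Sum>i\<le>n. f x i * A x i) > 0" if x: "x \<in> coordinate_sphere n" for x
  proof -
    have "f x i * F i x \<ge> (f x i)\<^sup>2 - \<epsilon>" if "i < n" for i
    proof -
      have "\<bar>f x i * (F i x - f x i)\<bar> \<le> 1 * \<epsilon>"
        unfolding abs_mult using app[OF that x] abs_coordinate_le_1[OF fim[OF x]]
        by (intro mult_mono) auto
      then show ?thesis
        by (simp add: power2_eq_square algebra_simps abs_le_iff)
    qed
    then have "(\<Sum>i<n. f x i * F i x) \<ge> (\<Sum>i<n. (f x i)\<^sup>2 - \<epsilon>)"
      by (intro sum_mono) auto
    moreover have "(\<Sum>i<n. f x i * A x i) = (\<Sum>i<n. f x i * F i x)"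
      by (intro sum.cong) (auto simp: A_def)
    moreover have "(\<Sum>i<n. (f x i)\<^sup>2) + (f x n)\<^sup>2 = 1"
      using fim[OF x] by (simp add: coordinate_sphere_def split)
    ultimately show ?thesis
      using \<epsilon>(2) unfolding split by (simp add: A_def sum_subtractf power2_eq_square)
  qed
  have AB: "(\<Sum>i\<le>n. A x i * B x i) > 0" if x: "x \<in> coordinate_sphere n" for x
  proof -
    have eq: "(\<Sum>i\<le>n. A x i * B x i) = (\<Sum>i<n. (F i x)\<^sup>2) + \<bar>x n\<bar> * (f x n)\<^sup>2"
      unfolding split by (simp add: A_def B_def power2_eq_square)
    \<comment> \<open>If the perturbed components all vanish at \<open>x\<close>, then
      \<open>x\<close> is off the equator, so the damping factor is positive, and \<open>fA\<close>
      makes the last component of \<open>f x\<close> nonzero.\<close>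
    show ?thesis
    proof (cases "\<exists>j<n. F j x \<noteq> 0")
      case True
      then have "(\<Sum>i<n. (F i x)\<^sup>2) > 0"
        by (auto intro!: sum_pos2)
      then show ?thesis
        unfolding eq by (intro add_pos_nonneg) auto
    next
      case False
      then have "x \<notin> coordinate_sphere (n - 1)"
        using nz by blast
      then have "x n \<noteq> 0"
        using x topspace_nsphere_minus1[of x n] by (auto simp: topspace_nsphere_eq)
      moreover have "(f x n)\<^sup>2 > 0"
        using fA[OF x] False unfolding split by (auto simp: A_def)
      ultimately show ?thesis
        unfolding eq by (intro add_nonneg_pos mult_pos_pos sum_nonneg) auto
    qed
  qed
  define g where "g = (\<lambda>x. normalized n (B x))"
  have "homotopic_with (\<lambda>_. True) (nsphere n) (nsphere n) (\<lambda>x. normalized n (f x)) g"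
    unfolding g_def
    using homotopic_normalized[OF cf cA fA] homotopic_normalized[OF cA cB AB]
    by (rule homotopic_with_trans)
  then have hom: "homotopic_with (\<lambda>_. True) (nsphere n) (nsphere n) f g"
    by (rule homotopic_with_eq) (auto simp: topspace_nsphere_eq fim normalized_id)
  show ?thesis
  proof (rule that[OF hom])
    have "B (\<lambda>i. - x i) = (\<lambda>i. - B x i)" if "x \<in> coordinate_sphere n" for x
      by (auto simp: B_def oddF odd'[OF that])
    then show "g (\<lambda>i. - x i) = (\<lambda>i. - g x i)" if "x \<in> coordinate_sphere n" for x
      using that by (simp add: g_def normalized_uminus)
    have gim: "g ` coordinate_sphere n \<subseteq> coordinate_sphere n"
      using homotopic_with_imp_continuous_maps[OF hom] continuous_map_nsphere_iff by blast
    show "g ` coordinate_sphere (n - 1) \<subseteq> coordinate_sphere (n - 1)"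
    proof (rule image_subsetI)
      fix x assume x: "x \<in> coordinate_sphere (n - 1)"
      then have "x n = 0"
        using n by (simp add: coordinate_sphere_def)
      then have "g x n = 0"
        by (simp add: g_def B_def normalized_def)
      moreover have "g x \<in> coordinate_sphere n"
        using gim x coordinate_sphere_mono[of "n - 1" n] by auto
      ultimately show "g x \<in> coordinate_sphere (n - 1)"
        using topspace_nsphere_minus1[of "g x" n] by (simp add: topspace_nsphere_eq)
    qed
  qed
qed

text \<open>Induction on the dimension: after the deformation, the degree has the parity of the
  degree of the map on the equator. The type \<open>'a\<close> provides the Euclidean space for the
  perturbations.\<close>

theorem odd_degree_odd_map:
  assumes "n \<le> CARD('a::finite)"
    and "continuous_map (nsphere n) (nsphere n) f"
    and "\<And>x. x \<in> coordinate_sphere n \<Longrightarrow> f (\<lambda>i. - x i) = (\<lambda>i. - f x i)"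
  shows "odd (Brouwer_degree2 n f)"
  using assms
proof (induction n arbitrary: f)
  case 0
  then show ?case
    by (intro odd_degree_nsphere_0) (auto simp: continuous_map_nsphere_iff)
next
  case (Suc n)
  obtain g where hom: "homotopic_with (\<lambda>_. True) (nsphere (Suc n)) (nsphere (Suc n)) f g"
    and g: "\<And>x. x \<in> coordinate_sphere (Suc n) \<Longrightarrow> g (\<lambda>i. - x i) = (\<lambda>i. - g x i)"
      "g ` coordinate_sphere n \<subseteq> coordinate_sphere n"
    using odd_map_homotopic_equator_preserving[OF _ Suc.prems] by (metis diff_Suc_1 zero_less_Suc)
  have cg: "continuous_map (nsphere (Suc n)) (nsphere (Suc n)) g"
    using homotopic_with_imp_continuous_maps[OF hom] by blast
  have "even (Brouwer_degree2 (Suc n) g - Brouwer_degree2 (Suc n - Suc 0) g)"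
    using g by (intro Borsuk_odd_mapping_degree_step cg) (auto simp: topspace_nsphere_eq)
  moreover have "odd (Brouwer_degree2 n g)"
  proof (rule Suc.IH)
    have "coordinate_sphere n \<subseteq> coordinate_sphere (Suc n)"
      by (simp add: coordinate_sphere_mono)
    then show "continuous_map (nsphere n) (nsphere n) g"
      and "\<And>x. x \<in> coordinate_sphere n \<Longrightarrow> g (\<lambda>i. - x i) = (\<lambda>i. - g x i)"
      using cg g by (auto simp: continuous_map_nsphere_iff intro: continuous_on_subset)
  qed (use Suc.prems in simp)
  ultimately show ?case
    using Brouwer_degree2_homotopic[OF hom] by simp
qed

text \<open>Viewed as a self-map of the sphere of dimension \<open>Suc m\<close>, \<open>h\<close>
  misses a pole and has degree 0; yet its degree has the same parity as that of its restriction to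
  the equator, which is odd.\<close>

theorem Borsuk_Ulam:
  assumes "m \<le> CARD('a::finite)" "m < n"
    and cont: "continuous_map (nsphere n) (nsphere m) h"
    and odd: "\<And>x. x \<in> coordinate_sphere n \<Longrightarrow> h (\<lambda>i. - x i) = (\<lambda>i. - h x i)"
  shows False
proof -
  have sub: "coordinate_sphere (Suc m) \<subseteq> coordinate_sphere n" "coordinate_sphere m \<subseteq> coordinate_sphere (Suc m)"
    using \<open>m < n\<close> by (simp_all add: coordinate_sphere_mono)
  have cont': "continuous_on (coordinate_sphere n) h" "h ` coordinate_sphere n \<subseteq> coordinate_sphere m"
    using cont by (simp_all add: continuous_map_nsphere_iff)
  have cSuc: "continuous_map (nsphere (Suc m)) (nsphere (Suc m)) h"
    and cm: "continuous_map (nsphere m) (nsphere m) h"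
    unfolding continuous_map_nsphere_iff
    using cont'(2) sub by (auto intro!: continuous_on_subset[OF cont'(1)])
  have "odd (Brouwer_degree2 m h)"
    by (rule odd_degree_odd_map[OF assms(1) cm]) (use odd sub in blast)
  moreover have "even (Brouwer_degree2 (Suc m) h - Brouwer_degree2 (Suc m - Suc 0) h)"
    using sub cont' odd by (intro Borsuk_odd_mapping_degree_step cSuc) (auto simp: topspace_nsphere_eq)
  moreover have "Brouwer_degree2 (Suc m) h = 0"
  proof (rule Brouwer_degree2_nonsurjective[OF cSuc])
    have "(\<lambda>i. if i = Suc m then 1 else 0) \<in> coordinate_sphere (Suc m) - coordinate_sphere m"
      by (auto simp: coordinate_sphere_def power2_eq_square)
    then show "h ` topspace (nsphere (Suc m)) \<noteq> topspace (nsphere (Suc m))"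
      unfolding topspace_nsphere_eq using cont'(2) sub by blast
  qed
  ultimately show False
    by simp
qed

section \<open>Genus and minimax values\<close>

text \<open>An odd map from \<open>A\<close> to a sphere of dimension \<open>j < m - 1\<close>,
  composed with \<open>g\<close>, would contradict \<open>Borsuk_Ulam\<close>. So an odd map out of
  a sphere bounds the genus of its target from below.\<close>

lemma le_genus:
  fixes A :: "'b::real_normed_vector set"
  assumes m: "0 < m" "m \<le> CARD('a::finite)"
    and g: "continuous_on (coordinate_sphere (m - 1)) g" "g ` coordinate_sphere (m - 1) \<subseteq> A"
    and odd: "\<And>x. x \<in> coordinate_sphere (m - 1) \<Longrightarrow> g (\<lambda>i. - x i) = - g x"
  shows "enat m \<le> genus A"
proof -
  have "A \<noteq> {}"
    using g(2) in_topspace_nsphere[of "m - 1"] by (auto simp: topspace_nsphere_eq)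
  moreover have "enat m \<le> enat (Suc j)"
    if h: "continuous_map (top_of_set A) (nsphere j) h" "\<forall>x\<in>A. \<forall>i. h (- x) i = - h x i" for j h
  proof (rule ccontr)
    assume "\<not> ?thesis"
    then have "j \<le> CARD('a)" "j < m - 1"
      using m by auto
    moreover have "continuous_map (nsphere (m - 1)) (top_of_set A) g"
      using g by (auto simp: nsphere_eq_top_of_set continuous_map_in_subtopology)
    then have "continuous_map (nsphere (m - 1)) (nsphere j) (h \<circ> g)"
      using h(1) by (rule continuous_map_compose)
    moreover have "(h \<circ> g) (\<lambda>i. - x i) = (\<lambda>i. - (h \<circ> g) x i)" if "x \<in> coordinate_sphere (m - 1)" for x
      using that g(2) h(2) by (auto simp: odd fun_eq_iff)
    ultimately show False
      by (rule Borsuk_Ulam)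
  qed
  ultimately show ?thesis
    by (auto simp: genus_def intro!: Inf_greatest)
qed

definition admissible_sets :: "nat \<Rightarrow> (real ^ 'n::finite) set set" where
  "admissible_sets k = {A. A \<subseteq> {x. infnorm x = 1} \<and> compact A \<and> uminus ` A = A \<and> enat k \<le> genus A}"

lemma compact_infnorm_sphere: "compact {x::'a::euclidean_space. infnorm x = 1}"
proof -
  have "norm x \<le> sqrt DIM('a)" if "infnorm x = 1" for x :: 'a
    using norm_le_infnorm[of x] that by simp
  then have "bounded {x::'a. infnorm x = 1}"
    by (auto simp: bounded_iff)
  moreover have "closed {x::'a. infnorm x = 1}"
    by (intro closed_Collect_eq continuous_on_infnorm continuous_on_id continuous_on_const)
  ultimately show ?thesis
    by (simp add: compact_eq_bounded_closed)
qed

text \<open>Linear combinations of \<open>k\<close> independent vectors of \<open>V\<close>,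
  rescaled to unit \<open>infnorm\<close>, give an odd continuous map from the sphere of dimension
  \<open>k - 1\<close> into the set.\<close>

lemma infnorm_sphere_of_subspace_admissible:
  fixes V :: "(real ^ 'n::finite) set"
  assumes V: "subspace V" and k: "0 < k" "k \<le> dim V"
  shows "V \<inter> {x. infnorm x = 1} \<in> admissible_sets k"
proof -
  obtain B where B: "B \<subseteq> V" "independent B" "V \<subseteq> span B" "card B = dim V"
    by (rule basis_exists)
  then have "finite B"
    using independent_imp_finite by blast
  then obtain b where b: "bij_betw b {0..<dim V} B"
    using ex_bij_betw_nat_finite B(4) by metis
  define K where "K = k - 1"
  have K: "k = Suc K" "k - 1 = K"
    using k by (auto simp: K_def)
  have inj: "inj_on b {..K}" and bB: "b ` {..K} \<subseteq> B"
    using b k by (auto simp: K bij_betw_def inj_on_def)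
  define L where "L = (\<lambda>x::nat \<Rightarrow> real. \<Sum>i\<le>K. x i *\<^sub>R b i)"
  have L0: "L x \<noteq> 0" if x: "x \<in> coordinate_sphere K" for x
  proof
    assume "L x = 0"
    moreover have "(\<Sum>v\<in>b ` {..K}. x (inv_into {..K} b v) *\<^sub>R v) = L x"
      unfolding sum.reindex[OF inj] L_def by (intro sum.cong) (simp_all add: inv_into_f_f[OF inj])
    ultimately have "(\<Sum>v\<in>b ` {..K}. x (inv_into {..K} b v) *\<^sub>R v) = 0"
      by simp
    from independentD[OF B(2) finite_imageI[OF finite_atMost] bB this]
    have "x (inv_into {..K} b (b i)) = 0" if "i \<le> K" for i
      using that by blast
    then have zero: "x i = 0" if "i \<le> K" for i
      using that by (metis inv_into_f_f[OF inj] atMost_iff)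
    have "(\<Sum>i\<le>K. (x i)\<^sup>2) = 0"
      by (simp add: zero)
    with x show False
      by (simp add: coordinate_sphere_def)
  qed
  have LV: "L x \<in> V" for x
    unfolding L_def using V bB B(1) by (intro subspace_sum subspace_scale) auto
  have cL: "continuous_on S L" for S
    unfolding L_def by (intro continuous_on_sum continuous_on_scaleR continuous_on_coordinate continuous_on_const)
  define g where "g = (\<lambda>x. inverse (infnorm (L x)) *\<^sub>R L x)"
  have "enat k \<le> genus (V \<inter> {x. infnorm x = 1})"
  proof (rule le_genus[where g = g and m = k, unfolded K(2)])
    show "k \<le> CARD('n)"
      using k dim_subset_UNIV_cart[of V] by simp
    show "continuous_on (coordinate_sphere K) g"
      unfolding g_def
      by (intro continuous_on_scaleR continuous_on_inverse continuous_on_infnorm cL) (simp add: L0 infnorm_eq_0)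
    show "g ` coordinate_sphere K \<subseteq> V \<inter> {x. infnorm x = 1}"
      using L0 by (auto simp: g_def infnorm_mul infnorm_eq_0 LV V subspace_scale abs_of_nonneg infnorm_pos_le)
    show "g (\<lambda>i. - x i) = - g x" for x
      by (simp add: g_def L_def sum_negf infnorm_neg)
  qed (use k in simp)
  moreover have "compact (V \<inter> {x. infnorm x = 1})"
    by (intro closed_Int_compact closed_subspace V compact_infnorm_sphere)
  moreover have "uminus ` (V \<inter> {x. infnorm x = 1}) = V \<inter> {x. infnorm x = 1}"
  proof -
    have "x \<in> uminus ` (V \<inter> {x. infnorm x = 1})" if "x \<in> V \<inter> {x. infnorm x = 1}" for x
      using that V by (intro image_eqI[of _ _ "- x"]) (auto simp: infnorm_neg subspace_neg)
    then show ?thesis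
      using V by (auto simp: infnorm_neg subspace_neg)
  qed
  ultimately show ?thesis
    by (simp add: admissible_sets_def)
qed

section \<open>Bounds and monotonicity of the minimax values\<close>

lemma total_variation_nonneg: "total_variation E x \<ge> 0"
  by (auto simp: total_variation_def intro!: sum_nonneg)

lemma vol_nonneg: "vol E \<ge> 0"
  by (simp add: vol_def sum_nonneg)

lemma vol_pos:
  assumes "E \<noteq> {}"
  shows "vol E > 0"
proof -
  obtain i j where "(i, j) \<in> E"
    using assms by auto
  then have "vertex_degree E i > 0"
    unfolding vertex_degree_def by (intro card_gt_0_iff[THEN iffD2]) auto
  then show ?thesis
    unfolding vol_def by (intro sum_pos2[of _ i]) auto
qed

lemma total_variation_le: "total_variation E x \<le> real (card E) * infnorm x"
proof -
  have "\<bar>x $ i - x $ j\<bar> \<le> 2 * infnorm x" for i j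
    using component_le_infnorm_cart[of x i] component_le_infnorm_cart[of x j] by linarith
  then have "(\<Sum>(i, j)\<in>E. \<bar>x $ i - x $ j\<bar>) \<le> (\<Sum>p\<in>E. 2 * infnorm x)"
    by (intro sum_mono) auto
  then show ?thesis
    by (simp add: total_variation_def)
qed

abbreviation maximal_quotient :: "'n::finite rel \<Rightarrow> (real ^ 'n) set \<Rightarrow> real" where
  "maximal_quotient E A \<equiv> (SUP x\<in>A. total_variation E x / (vol E * infnorm x))"

lemma minimax_value_eq: "minimax_value E k = (INF A\<in>admissible_sets k. maximal_quotient E A)"
  by (simp add: minimax_value_def admissible_sets_def)

lemma admissible_nonempty: "\<lbrakk>A \<in> admissible_sets k; 0 < k\<rbrakk> \<Longrightarrow> A \<noteq> {}"
  by (auto simp: admissible_sets_def genus_def zero_enat_def)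

text \<open>Over the reals \<open>INF\<close> and \<open>SUP\<close> need bounds to be meaningful.
  On an admissible set the quotients lie between 0 and \<open>card E / vol E\<close>, and for
  \<open>0 < k\<close> such a set is nonempty, so its supremum is nonnegative.\<close>

lemma bdd_below_maximal_quotient:
  fixes E :: "'n::finite rel"
  assumes "0 < k"
  shows "bdd_below (maximal_quotient E ` admissible_sets k)"
proof (rule bdd_belowI2)
  fix A :: "(real ^ 'n) set" assume A: "A \<in> admissible_sets k"
  then obtain x where x: "x \<in> A"
    using admissible_nonempty assms by blast
  have "bdd_above ((\<lambda>x. total_variation E x / (vol E * infnorm x)) ` A)"
  proof (rule bdd_aboveI2)
    fix y assume "y \<in> A"
    then have "infnorm y = 1"
      using A by (auto simp: admissible_sets_def)
    then show "total_variation E y / (vol E * infnorm y) \<le> real (card E) / vol E"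
      using total_variation_le[of E y] by (simp add: divide_right_mono vol_nonneg)
  qed
  then show "0 \<le> maximal_quotient E A"
    by (rule cSUP_upper2[OF _ x]) (simp add: total_variation_nonneg vol_nonneg infnorm_pos_le)
qed

lemma minimax_value_le:
  assumes "0 < k" "A \<in> admissible_sets k"
    and "\<And>x. x \<in> A \<Longrightarrow> total_variation E x / (vol E * infnorm x) \<le> \<mu>"
  shows "minimax_value E k \<le> \<mu>"
  unfolding minimax_value_eq
proof (rule cINF_lower2[OF bdd_below_maximal_quotient])
  show "maximal_quotient E A \<le> \<mu>"
    using assms admissible_nonempty by (intro cSUP_least) auto
qed (use assms in auto)

text \<open>The family of admissible sets shrinks as the index grows. The bound by
  \<open>CARD('n)\<close> makes the smaller family nonempty, since it contains the unit sphere of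
  the whole space.\<close>

lemma minimax_value_mono:
  fixes E :: "'n::finite rel"
  assumes "0 < i" "i \<le> j" "j \<le> CARD('n)"
  shows "minimax_value E i \<le> minimax_value E j"
  unfolding minimax_value_eq
proof (rule cINF_superset_mono)
  show "admissible_sets j \<noteq> ({} :: (real ^ 'n) set set)"
    using infnorm_sphere_of_subspace_admissible[of "UNIV :: (real ^ 'n) set" j] assms
    by (auto simp: dim_UNIV)
  show "admissible_sets j \<subseteq> (admissible_sets i :: (real ^ 'n) set set)"
    using assms(2) by (auto simp: admissible_sets_def intro: order_trans[of "enat i" "enat j"])
qed (use assms bdd_below_maximal_quotient in auto)

text \<open>The unit sphere of \<open>V\<close> is admissible for every positive index up to
  \<open>dim V\<close>, so these minimax values are at most the \<open>k\<close>-th; by monotonicity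
  they equal it from index \<open>k\<close> on, and the multiplicity counts them.\<close>

lemma dim_le_of_total_variation_le:
  fixes E :: "'n::finite rel"
  assumes "E \<noteq> {}" and k: "k \<in> {1..CARD('n)}" and V: "subspace V"
    and le: "\<And>x. x \<in> V \<Longrightarrow> total_variation E x \<le> minimax_value E k * vol E * infnorm x"
  shows "dim V + 1 \<le> k + multiplicity_at E k"
proof -
  let ?J = "{j \<in> {1..CARD('n)}. minimax_value E j = minimax_value E k}"
  have upper: "minimax_value E j \<le> minimax_value E k" if "0 < j" "j \<le> dim V" for j
  proof (rule minimax_value_le[OF that(1) infnorm_sphere_of_subspace_admissible[OF V that]])
    show "total_variation E x / (vol E * infnorm x) \<le> minimax_value E k"
      if "x \<in> V \<inter> {x. infnorm x = 1}" for x
      using that le[of x] vol_pos[OF \<open>E \<noteq> {}\<close>] by (simp add: divide_le_eq)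
  qed
  have "dim V \<le> CARD('n)"
    by (rule dim_subset_UNIV_cart)
  \<comment> \<open>Inserting \<open>k\<close> covers the case \<open>dim V < k\<close>, where the
    interval is empty but \<open>k\<close> still counts itself.\<close>
  then have "insert k {k..dim V} \<subseteq> ?J"
    using k upper minimax_value_mono[of k _ E] by (auto intro: antisym)
  then have "card (insert k {k..dim V}) \<le> card ?J"
    by (intro card_mono) auto
  moreover have "card (insert k {k..dim V}) \<ge> dim V + 1 - k"
  proof -
    have "card {k..dim V} \<le> card (insert k {k..dim V})"
      by (intro card_mono) auto
    then show ?thesis
      by simp
  qed
  moreover have "card (insert k {k..dim V}) \<ge> 1"
    by (simp add: Suc_le_eq card_gt_0_iff)
  ultimately show ?thesis
    unfolding multiplicity_at_def by linarith
qed

section \<open>Subspaces attached to an eigenvector\<close>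

definition indicator_vector :: "'n set \<Rightarrow> real ^ 'n::finite" where
  "indicator_vector C = (\<chi> i. if i \<in> C then 1 else 0)"

lemma inner_vec_eq_0: "(\<And>i. x $ i = 0 \<or> y $ i = 0) \<Longrightarrow> x \<bullet> y = (0::real)"
  for x y :: "real ^ 'n::finite"
  unfolding inner_vec_def by (intro sum.neutral) auto

text \<open>Vectors with disjoint supports are orthogonal, hence independent when nonzero. The set
  \<open>X\<close> will be empty or hold only the sign pattern.\<close>

lemma card_le_dim_of_disjoint_supports:
  fixes V :: "(real ^ 'n::finite) set"
  assumes V: "indicator_vector ` \<C> \<union> X \<subseteq> V"
    and disj: "\<And>C C'. \<lbrakk>C \<in> \<C>; C' \<in> \<C>; C \<noteq> C'\<rbrakk> \<Longrightarrow> C \<inter> C' = {}" and "{} \<notin> \<C>"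
    and X: "pairwise orthogonal X" "0 \<notin> X" "\<And>x C i. \<lbrakk>x \<in> X; C \<in> \<C>; i \<in> C\<rbrakk> \<Longrightarrow> x $ i = 0"
  shows "card \<C> + card X \<le> dim V"
proof -
  have ortho: "orthogonal (indicator_vector C) (indicator_vector C')"
    if "C \<in> \<C>" "C' \<in> \<C>" "C \<noteq> C'" for C C'
    unfolding orthogonal_def using disj[OF that]
    by (intro inner_vec_eq_0) (auto simp: indicator_vector_def)
  have ortho_X: "orthogonal (indicator_vector C) x" "orthogonal x (indicator_vector C)"
    if "C \<in> \<C>" "x \<in> X" for C x
    unfolding orthogonal_def using X(3)[OF that(2,1)]
    by (intro inner_vec_eq_0; auto simp: indicator_vector_def)+
  have nz: "indicator_vector C \<noteq> 0" if "C \<in> \<C>" for C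
  proof -
    have "C \<noteq> {}"
      using that \<open>{} \<notin> \<C>\<close> by blast
    then obtain i where "i \<in> C"
      by blast
    then have "indicator_vector C $ i \<noteq> 0"
      by (simp add: indicator_vector_def)
    then show ?thesis
      by auto
  qed
  let ?B = "indicator_vector ` \<C> \<union> X"
  have inj: "inj_on indicator_vector \<C>"
    by (intro inj_onI) (auto simp: indicator_vector_def vec_eq_iff split: if_splits)
  have "indicator_vector ` \<C> \<inter> X = {}"
    using ortho_X(1) nz by (auto simp: orthogonal_self[symmetric] simp del: orthogonal_self)
  moreover have ind: "independent ?B"
  proof (rule pairwise_orthogonal_independent)
    show "pairwise orthogonal ?B"
      using ortho ortho_X X(1) by (auto simp: pairwise_def)
    show "0 \<notin> ?B"
      using nz X(2) by force
  qed
  ultimately have "card ?B = card \<C> + card X"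
    using independent_imp_finite[OF ind] card_image[OF inj] by (simp add: card_Un_disjoint)
  moreover have "card ?B \<le> dim V"
    using V ind by (rule independent_card_le_dim)
  ultimately show ?thesis
    by simp
qed

section \<open>Components of induced subgraphs\<close>

context
  fixes E :: "'n rel"
  assumes "sym E"
begin

text \<open>The reflexive closure makes every vertex outside \<open>D\<close> a class of its own, so
  the equivalence is on all of \<open>UNIV\<close>; taking the quotient of \<open>D\<close> alone
  leaves those classes out.\<close>

lemma equiv_component_relation: "equiv UNIV ((Restr E D)\<^sup>*)"
proof (rule equivI)
  show "sym ((Restr E D)\<^sup>*)"
    using \<open>sym E\<close> by (intro sym_rtrancl) (auto simp: sym_def)
qed (auto simp: refl_rtrancl trans_rtrancl)

lemma components_subset: "C \<in> D // (Restr E D)\<^sup>* \<Longrightarrow> C \<subseteq> D"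
  by (auto simp: quotient_def elim: rtrancl.cases)

lemma components_disjoint:
  assumes "C \<in> D // (Restr E D)\<^sup>*" "C' \<in> D // (Restr E D)\<^sup>*" "C \<noteq> C'"
  shows "C \<inter> C' = {}"
proof -
  have "D // (Restr E D)\<^sup>* \<subseteq> UNIV // (Restr E D)\<^sup>*"
    by (auto simp: quotient_def)
  then show ?thesis
    using quotient_disj[OF equiv_component_relation] assms by blast
qed

lemma empty_not_component: "{} \<notin> D // (Restr E D)\<^sup>*"
  by (auto simp: quotient_def)

lemma edge_same_component:
  assumes "C \<in> D // (Restr E D)\<^sup>*" "(i, j) \<in> E" "i \<in> D" "j \<in> D"
  shows "i \<in> C \<longleftrightarrow> j \<in> C"
proof -
  have "(i, j) \<in> Restr E D" "(j, i) \<in> Restr E D"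
    using assms \<open>sym E\<close> by (auto dest: symD)
  with assms(1) show ?thesis
    by (auto simp: quotient_def intro: rtrancl_into_rtrancl)
qed

end

section \<open>Sign patterns and subgradients of the maximum norm\<close>

definition sign_pattern :: "real ^ 'n::finite \<Rightarrow> real ^ 'n" where
  "sign_pattern x = (\<chi> i. if i \<in> D_plus x then 1 else if i \<in> D_minus x then - 1 else 0)"

lemma D_trichotomy: "i \<in> D_plus x \<or> i \<in> D_minus x \<or> i \<in> D_zero x"
  using component_le_infnorm_cart[of x i]
  by (auto simp: D_plus_def D_minus_def D_zero_def abs_if split: if_splits)

lemma D_disjoint:
  assumes "x \<noteq> 0"
  shows "D_plus x \<inter> D_minus x = {}" "D_plus x \<inter> D_zero x = {}" "D_minus x \<inter> D_zero x = {}"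
proof -
  have "infnorm x > 0"
    using assms by (simp add: infnorm_pos_lt)
  then show "D_plus x \<inter> D_minus x = {}" "D_plus x \<inter> D_zero x = {}" "D_minus x \<inter> D_zero x = {}"
    by (auto simp: D_plus_def D_minus_def D_zero_def abs_if split: if_splits)
qed

lemma infnorm_le: "(\<And>i. \<bar>x $ i\<bar> \<le> b) \<Longrightarrow> infnorm x \<le> b" for x :: "real ^ 'n::finite"
  unfolding infnorm_cart by (rule cSup_least) auto

text \<open>A subgradient has l1 norm at most 1 and pairs with \<open>x\<close> to
  \<open>infnorm x\<close>; equality in Hoelder's inequality puts its support on the extremal
  coordinates, with matching signs.\<close>

lemma subdifferential_infnorm:
  fixes x u :: "real ^ 'n::finite"
  assumes "x \<noteq> 0" and u: "u \<in> subdifferential infnorm x"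
  shows "\<And>i. i \<in> D_zero x \<Longrightarrow> u $ i = 0" "u \<bullet> sign_pattern x = 1"
proof -
  have sub: "infnorm x + u \<bullet> (y - x) \<le> infnorm y" for y
    using u by (simp add: subdifferential_def)
  have pos: "infnorm x > 0"
    using \<open>x \<noteq> 0\<close> by (simp add: infnorm_pos_lt)
  \<comment> \<open>Comparison with \<open>0\<close> and \<open>x + x\<close> gives the two
    inequalities of Euler's identity for a homogeneous function.\<close>
  have ux: "u \<bullet> x = infnorm x"
    using sub[of 0] sub[of "x + x"] infnorm_triangle[of x x] by (simp add: infnorm_0)
  have dual: "u \<bullet> y \<le> infnorm y" for y
    using sub[of "x + y"] infnorm_triangle[of x y] by simp
  \<comment> \<open>Testing the dual bound against the signs of \<open>u\<close> bounds its l1 norm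
    by 1.\<close>
  define s where "s = (\<chi> i. sgn (u $ i))"
  have "(\<Sum>i\<in>UNIV. \<bar>u $ i\<bar>) = u \<bullet> s"
    by (simp add: inner_vec_def s_def abs_sgn)
  also have "\<dots> \<le> infnorm s"
    by (rule dual)
  also have "\<dots> \<le> 1"
    by (rule infnorm_le) (simp add: s_def abs_sgn_eq)
  finally have "(\<Sum>i\<in>UNIV. \<bar>u $ i\<bar>) * infnorm x \<le> 1 * infnorm x"
    using pos by (intro mult_right_mono) auto
  then have "(\<Sum>i\<in>UNIV. \<bar>u $ i\<bar> * infnorm x - u $ i * x $ i) \<le> 0"
    using ux by (simp add: sum_subtractf sum_distrib_right inner_vec_def)
  moreover have term_nonneg: "\<bar>u $ i\<bar> * infnorm x - u $ i * x $ i \<ge> 0" for i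
  proof -
    have "u $ i * x $ i \<le> \<bar>u $ i\<bar> * \<bar>x $ i\<bar>"
      by (metis abs_ge_self abs_mult)
    also have "\<dots> \<le> \<bar>u $ i\<bar> * infnorm x"
      by (intro mult_left_mono component_le_infnorm_cart) auto
    finally show ?thesis by simp
  qed
  ultimately have "(\<Sum>i\<in>UNIV. \<bar>u $ i\<bar> * infnorm x - u $ i * x $ i) = 0"
    by (intro antisym sum_nonneg) auto
  then have eq: "\<bar>u $ i\<bar> * infnorm x = u $ i * x $ i" for i
    using term_nonneg by (simp add: sum_nonneg_eq_0_iff)
  show zero: "u $ i = 0" if "i \<in> D_zero x" for i
  proof (rule ccontr)
    assume "u $ i \<noteq> 0"
    then have "\<bar>u $ i\<bar> * \<bar>x $ i\<bar> < \<bar>u $ i\<bar> * infnorm x"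
      using that by (simp add: D_zero_def)
    then show False
      using eq[of i] abs_ge_self[of "u $ i * x $ i"] by (simp add: abs_mult)
  qed
  have sign: "u $ i * sign_pattern x $ i * infnorm x = u $ i * x $ i" for i
    using D_trichotomy[of i x] zero[of i] by (auto simp: sign_pattern_def D_plus_def D_minus_def)
  have "(u \<bullet> sign_pattern x) * infnorm x = u \<bullet> x"
    by (simp only: inner_vec_def inner_real_def sum_distrib_right sign)
  then show "u \<bullet> sign_pattern x = 1"
    using ux pos by simp
qed

text \<open>The weak form of the eigenvalue equation: pair it with a test vector and sum by parts
  over the edges, using the antisymmetry of \<open>z\<close>. The halving accounts for the two
  orientations.\<close>

lemma eigenpair_selection:
  fixes E :: "'n::finite rel"
  assumes "sym E" and "eigenpair E \<mu> \<phi>"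
  obtains z u where "\<And>i j. (i, j) \<in> E \<Longrightarrow> z i j \<in> Sgn (\<phi> $ i - \<phi> $ j)"
    "u \<in> subdifferential infnorm \<phi>"
    "\<And>x. (\<Sum>(i, j)\<in>E. z i j * (x $ i - x $ j)) / 2 = \<mu> * vol E * (u \<bullet> x)"
proof -
  obtain z u where z: "\<And>i j. (i, j) \<in> E \<Longrightarrow> z i j \<in> Sgn (\<phi> $ i - \<phi> $ j) \<and> z i j = - z j i"
    and u: "u \<in> subdifferential infnorm \<phi>"
    and y: "\<And>i. ((\<mu> * vol E) *\<^sub>R u) $ i = (\<Sum>j | (i, j) \<in> E. z i j)"
    using assms(2) unfolding eigenpair_def one_laplacian_def by blast
  have "(\<Sum>(i, j)\<in>E. z i j * (x $ i - x $ j)) / 2 = \<mu> * vol E * (u \<bullet> x)" for x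
  proof -
    have E: "E = (SIGMA i:UNIV. {j. (i, j) \<in> E})"
      by auto
    have "(\<Sum>(i, j)\<in>E. z i j * x $ i) = (\<Sum>i\<in>UNIV. \<Sum>j | (i, j) \<in> E. z i j * x $ i)"
      by (subst E, subst sum.Sigma) auto
    also have "\<dots> = \<mu> * vol E * (u \<bullet> x)"
      by (simp add: sum_distrib_right[symmetric] y[symmetric] inner_vec_def sum_distrib_left mult.assoc)
    finally have 1: "(\<Sum>(i, j)\<in>E. z i j * x $ i) = \<mu> * vol E * (u \<bullet> x)" .
    have "(\<Sum>(i, j)\<in>E. z i j * x $ j) = (\<Sum>(i, j)\<in>E. - (z i j * x $ i))"
      using \<open>sym E\<close>
      by (intro sum.reindex_bij_witness[of _ prod.swap prod.swap]) (auto dest: symD z)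
    then have 2: "(\<Sum>(i, j)\<in>E. z i j * x $ j) = - (\<Sum>(i, j)\<in>E. z i j * x $ i)"
      by (simp add: sum_negf case_prod_beta)
    have "(\<Sum>(i, j)\<in>E. z i j * (x $ i - x $ j)) = (\<Sum>(i, j)\<in>E. z i j * x $ i) - (\<Sum>(i, j)\<in>E. z i j * x $ j)"
      by (simp add: sum_subtractf case_prod_beta right_diff_distrib)
    with 1 2 show ?thesis
      by simp
  qed
  then show ?thesis
    using that[of z u] z u by blast
qed

lemma sign_pattern_simps:
  assumes "x \<noteq> 0"
  shows "i \<in> D_plus x \<Longrightarrow> sign_pattern x $ i = 1"
    and "i \<in> D_minus x \<Longrightarrow> sign_pattern x $ i = - 1"
    and "i \<in> D_zero x \<Longrightarrow> sign_pattern x $ i = 0"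
  using D_disjoint[OF assms] by (auto simp: sign_pattern_def)

text \<open>The sign pattern is a nondecreasing function of the entries of \<open>x\<close>, so a
  selection for \<open>x\<close> also realizes the absolute differences of the pattern.\<close>

lemma Sgn_sign_pattern:
  assumes "x \<noteq> 0" and z: "z \<in> Sgn (x $ i - x $ j)"
  shows "\<bar>sign_pattern x $ i - sign_pattern x $ j\<bar> = z * (sign_pattern x $ i - sign_pattern x $ j)"
proof -
  have le: "x $ i \<le> infnorm x" "- infnorm x \<le> x $ i" "x $ j \<le> infnorm x" "- infnorm x \<le> x $ j"
    using component_le_infnorm_cart[of x i] component_le_infnorm_cart[of x j] by linarith+
  have mono: "sign_pattern x $ a \<le> sign_pattern x $ b" if "x $ a \<le> x $ b" for a b
    using that component_le_infnorm_cart[of x a] component_le_infnorm_cart[of x b] \<open>x \<noteq> 0\<close>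
      infnorm_pos_lt[of x]
    by (auto simp: sign_pattern_def D_plus_def D_minus_def)
  consider "x $ i > x $ j" | "x $ i = x $ j" | "x $ i < x $ j"
    by linarith
  then show ?thesis
    using z mono[of i j] mono[of j i] by cases (auto simp: Sgn_def)
qed

text \<open>
  Summing the edgewise bound turns the correction term \<open>z i j * (c i - c j)\<close> into the pairing of
  \<open>c\<close> with the subgradient, which vanishes because \<open>c\<close> lives on \<open>D_zero\<close>.
\<close>

lemma total_variation_le_of_edgewise:
  fixes E :: "'n::finite rel"
  assumes "\<phi> \<noteq> 0"
    and z: "\<And>i j. (i, j) \<in> E \<Longrightarrow> z i j \<in> Sgn (\<phi> $ i - \<phi> $ j)"
    and u: "u \<in> subdifferential infnorm \<phi>"
    and sum: "\<And>x. (\<Sum>(i, j)\<in>E. z i j * (x $ i - x $ j)) / 2 = \<mu> * vol E * (u \<bullet> x)"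
    and c: "\<And>i. i \<notin> D_zero \<phi> \<Longrightarrow> c $ i = 0"
    and edge: "\<And>i j. (i, j) \<in> E \<Longrightarrow> \<bar>x $ i - x $ j\<bar> \<le>
      infnorm x * \<bar>sign_pattern \<phi> $ i - sign_pattern \<phi> $ j\<bar> + z i j * (c $ i - c $ j)"
  shows "total_variation E x \<le> \<mu> * vol E * infnorm x"
proof -
  let ?\<sigma> = "sign_pattern \<phi>"
  have "u \<bullet> c = 0"
    using c subdifferential_infnorm(1)[OF \<open>\<phi> \<noteq> 0\<close> u] by (intro inner_vec_eq_0) blast
  have "(\<Sum>(i, j)\<in>E. \<bar>x $ i - x $ j\<bar>) \<le>
      (\<Sum>(i, j)\<in>E. infnorm x * (z i j * (?\<sigma> $ i - ?\<sigma> $ j)) + z i j * (c $ i - c $ j))"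
    using edge Sgn_sign_pattern[OF \<open>\<phi> \<noteq> 0\<close> z] by (intro sum_mono) (fastforce simp: case_prod_beta)
  also have "\<dots> = infnorm x * (\<Sum>(i, j)\<in>E. z i j * (?\<sigma> $ i - ?\<sigma> $ j)) + (\<Sum>(i, j)\<in>E. z i j * (c $ i - c $ j))"
    by (simp add: sum.distrib case_prod_beta sum_distrib_left)
  finally show ?thesis
    using sum[of ?\<sigma>] sum[of c] subdifferential_infnorm(2)[OF \<open>\<phi> \<noteq> 0\<close> u] \<open>u \<bullet> c = 0\<close>
    by (simp add: total_variation_def algebra_simps)
qed

text \<open>
  The first subspace contains the indicators of the components of \<open>D_plus\<close> and \<open>D_minus\<close>, the second the
  indicators of the components of \<open>D_zero\<close> together with the sign pattern; the additional dimension
  accounts for the \<open>- 2\<close> in the second bound.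
\<close>

definition extremal_subspace :: "'n::finite rel \<Rightarrow> real ^ 'n \<Rightarrow> (real ^ 'n) set" where
  "extremal_subspace E \<phi> =
    {x. (\<forall>i\<in>D_zero \<phi>. x $ i = 0) \<and>
        (\<forall>(i, j)\<in>E. i \<in> D_plus \<phi> \<and> j \<in> D_plus \<phi> \<or> i \<in> D_minus \<phi> \<and> j \<in> D_minus \<phi> \<longrightarrow> x $ i = x $ j)}"

definition interior_subspace :: "'n::finite rel \<Rightarrow> real ^ 'n \<Rightarrow> (real ^ 'n) set" where
  "interior_subspace E \<phi> =
    {x. (\<exists>s. \<forall>i. i \<notin> D_zero \<phi> \<longrightarrow> x $ i = s * sign_pattern \<phi> $ i) \<and>
        (\<forall>(i, j)\<in>E. i \<in> D_zero \<phi> \<and> j \<in> D_zero \<phi> \<longrightarrow> x $ i = x $ j)}"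

lemma subspace_extremal_subspace: "subspace (extremal_subspace E \<phi>)"
  unfolding subspace_def extremal_subspace_def by fastforce

lemma subspace_interior_subspace: "subspace (interior_subspace E \<phi>)"
  unfolding subspace_def
proof (intro conjI ballI allI)
  show "0 \<in> interior_subspace E \<phi>"
    by (auto simp: interior_subspace_def intro: exI[of _ 0])
next
  fix x y assume xy: "x \<in> interior_subspace E \<phi>" "y \<in> interior_subspace E \<phi>"
  then obtain s t where "\<forall>i. i \<notin> D_zero \<phi> \<longrightarrow> x $ i = s * sign_pattern \<phi> $ i"
    "\<forall>i. i \<notin> D_zero \<phi> \<longrightarrow> y $ i = t * sign_pattern \<phi> $ i"
    by (auto simp: interior_subspace_def)
  then have "\<forall>i. i \<notin> D_zero \<phi> \<longrightarrow> (x + y) $ i = (s + t) * sign_pattern \<phi> $ i"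
    by (simp add: distrib_right)
  with xy show "x + y \<in> interior_subspace E \<phi>"
    unfolding interior_subspace_def by fastforce
next
  fix c x assume x: "x \<in> interior_subspace E \<phi>"
  then obtain s where "\<forall>i. i \<notin> D_zero \<phi> \<longrightarrow> x $ i = s * sign_pattern \<phi> $ i"
    by (auto simp: interior_subspace_def)
  then have "\<forall>i. i \<notin> D_zero \<phi> \<longrightarrow> (c *\<^sub>R x) $ i = (c * s) * sign_pattern \<phi> $ i"
    by simp
  with x show "c *\<^sub>R x \<in> interior_subspace E \<phi>"
    unfolding interior_subspace_def by fastforce
qed

section \<open>Dimensions of the two subspaces\<close>

lemma S_pm_le_dim:
  fixes E :: "'n::finite rel"
  assumes "sym E" "\<phi> \<noteq> 0"
  shows "S_pm E \<phi> \<le> dim (extremal_subspace E \<phi>)"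
proof -
  let ?P = "D_plus \<phi> // (Restr E (D_plus \<phi>))\<^sup>*"
  let ?M = "D_minus \<phi> // (Restr E (D_minus \<phi>))\<^sup>*"
  note D = D_disjoint[OF assms(2)]
  note sub = components_subset[OF assms(1)]
  note ne = empty_not_component[OF assms(1)]
  \<comment> \<open>Opposite signs never share a vertex, so no component is counted twice in the
    union.\<close>
  have cross: "C \<inter> C' = {}" if "C \<in> ?P" "C' \<in> ?M" for C C'
    using sub[OF that(1)] sub[OF that(2)] D(1) by blast
  have "C \<notin> ?M" if "C \<in> ?P" for C
  proof
    assume "C \<in> ?M"
    from cross[OF that this] that show False
      by (simp add: ne)
  qed
  then have "?P \<inter> ?M = {}"
    by blast
  then have "S_pm E \<phi> = card (?P \<union> ?M)"
    unfolding S_pm_def num_components_def by (subst card_Un_disjoint) auto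
  moreover have "card (?P \<union> ?M) + card ({} :: (real ^ 'n) set) \<le> dim (extremal_subspace E \<phi>)"
  proof (rule card_le_dim_of_disjoint_supports)
    have "indicator_vector C \<in> extremal_subspace E \<phi>" if "C \<in> ?P \<union> ?M" for C
    proof -
      have "i \<notin> C" if "i \<in> D_zero \<phi>" for i
        using \<open>C \<in> ?P \<union> ?M\<close> sub[of C] that D by blast
      moreover have "i \<in> C \<longleftrightarrow> j \<in> C"
        if "(i, j) \<in> E" "i \<in> D_plus \<phi> \<and> j \<in> D_plus \<phi> \<or> i \<in> D_minus \<phi> \<and> j \<in> D_minus \<phi>" for i j
        using \<open>C \<in> ?P \<union> ?M\<close> that edge_same_component[OF assms(1), of C _ i j] sub[of C] D(1) by blast
      ultimately show ?thesis
        by (auto simp: extremal_subspace_def indicator_vector_def)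
    qed
    then show "indicator_vector ` (?P \<union> ?M) \<union> {} \<subseteq> extremal_subspace E \<phi>"
      by blast
    show "C \<inter> C' = {}" if "C \<in> ?P \<union> ?M" "C' \<in> ?P \<union> ?M" "C \<noteq> C'" for C C'
      using that components_disjoint[OF assms(1)] cross by blast
  qed (use ne in auto)
  ultimately show ?thesis
    by simp
qed

lemma S_zero_le_dim:
  fixes E :: "'n::finite rel"
  assumes "sym E" "\<phi> \<noteq> 0" "sign_pattern \<phi> \<noteq> 0"
  shows "S_zero E \<phi> + 1 \<le> dim (interior_subspace E \<phi>)"
proof -
  let ?Z = "D_zero \<phi> // (Restr E (D_zero \<phi>))\<^sup>*"
  note sub = components_subset[OF assms(1)]
  have "card ?Z + card {sign_pattern \<phi>} \<le> dim (interior_subspace E \<phi>)"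
  proof (rule card_le_dim_of_disjoint_supports)
    have "indicator_vector C \<in> interior_subspace E \<phi>" if C: "C \<in> ?Z" for C
      using sub[OF C] edge_same_component[OF assms(1) C]
      by (auto simp: interior_subspace_def indicator_vector_def intro!: exI[of _ 0])
    moreover have "sign_pattern \<phi> \<in> interior_subspace E \<phi>"
      using sign_pattern_simps(3)[OF assms(2)]
      by (auto simp: interior_subspace_def intro!: exI[of _ 1])
    ultimately show "indicator_vector ` ?Z \<union> {sign_pattern \<phi>} \<subseteq> interior_subspace E \<phi>"
      by blast
    show "C \<inter> C' = {}" if "C \<in> ?Z" "C' \<in> ?Z" "C \<noteq> C'" for C C'
      using components_disjoint[OF assms(1) that] .
    show "x $ i = 0" if "x \<in> {sign_pattern \<phi>}" "C \<in> ?Z" "i \<in> C" for x C i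
      using that sub[OF that(2)] sign_pattern_simps(3)[OF assms(2)] by auto
  qed (use empty_not_component[OF assms(1)] assms(3) in auto)
  then show ?thesis
    by (simp add: S_zero_def num_components_def)
qed

section \<open>Total variation on the two subspaces\<close>

context
  fixes E :: "'n::finite rel" and \<phi> :: "real ^ 'n" and \<mu> :: real
  assumes sym: "sym E" and eigen: "eigenpair E \<mu> \<phi>"
begin

lemma eigenvector_nonzero: "\<phi> \<noteq> 0"
  using eigen by (simp add: eigenpair_def)

text \<open>An edge difference vanishes where the pattern agrees and is at most one or two times
  \<open>infnorm x\<close> where the pattern differs by one or two, so the correction vector is
  taken to be zero.\<close>

lemma total_variation_le_extremal_subspace:
  assumes x: "x \<in> extremal_subspace E \<phi>"
  shows "total_variation E x \<le> \<mu> * vol E * infnorm x"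
proof (rule eigenpair_selection[OF sym eigen])
  fix z u
  assume zu: "\<And>i j. (i, j) \<in> E \<Longrightarrow> z i j \<in> Sgn (\<phi> $ i - \<phi> $ j)"
    "u \<in> subdifferential infnorm \<phi>"
    "\<And>x. (\<Sum>(i, j)\<in>E. z i j * (x $ i - x $ j)) / 2 = \<mu> * vol E * (u \<bullet> x)"
  note \<sigma> = sign_pattern_simps[OF eigenvector_nonzero]
  show ?thesis
  proof (rule total_variation_le_of_edgewise[OF eigenvector_nonzero zu, where c = 0])
    fix i j assume ij: "(i, j) \<in> E"
    have le: "\<bar>x $ i\<bar> \<le> infnorm x" "\<bar>x $ j\<bar> \<le> infnorm x"
      by (rule component_le_infnorm_cart)+
    have zero: "x $ a = 0" if "a \<in> D_zero \<phi>" for a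
      using x that by (simp add: extremal_subspace_def)
    have const: "x $ i = x $ j"
      if "i \<in> D_plus \<phi> \<and> j \<in> D_plus \<phi> \<or> i \<in> D_minus \<phi> \<and> j \<in> D_minus \<phi>"
      using x that ij by (auto simp: extremal_subspace_def)
    have "\<bar>x $ i - x $ j\<bar> \<le> infnorm x * \<bar>sign_pattern \<phi> $ i - sign_pattern \<phi> $ j\<bar>"
      using D_trichotomy[of i \<phi>] D_trichotomy[of j \<phi>]
    proof (elim disjE)
      assume "i \<in> D_plus \<phi>" "j \<in> D_plus \<phi>"
      then show ?thesis using const by (simp add: \<sigma>)
    next
      assume "i \<in> D_minus \<phi>" "j \<in> D_minus \<phi>"
      then show ?thesis using const by (simp add: \<sigma>)
    qed (use le in \<open>auto simp: \<sigma> zero\<close>)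
    then show "\<bar>x $ i - x $ j\<bar> \<le> infnorm x * \<bar>sign_pattern \<phi> $ i - sign_pattern \<phi> $ j\<bar>
        + z i j * ((0 :: real ^ 'n) $ i - 0 $ j)"
      by simp
  qed auto
qed

text \<open>
  Between an interior value \<open>t\<close> and a boundary value \<open>\<plusminus>s\<close> one has
  \<open>\<bar>t - s\<bar> = max \<bar>s\<bar> \<bar>t\<bar> - c\<close> and \<open>\<bar>t + s\<bar> = max \<bar>s\<bar> \<bar>t\<bar> + c\<close> with the same
  \<open>c = (\<bar>t + s\<bar> - \<bar>t - s\<bar>) / 2\<close>; this is the correction vector used below.
\<close>

lemma total_variation_le_interior_subspace:
  assumes x: "x \<in> interior_subspace E \<phi>"
  shows "total_variation E x \<le> \<mu> * vol E * infnorm x"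
proof (rule eigenpair_selection[OF sym eigen])
  fix z u
  assume zu: "\<And>i j. (i, j) \<in> E \<Longrightarrow> z i j \<in> Sgn (\<phi> $ i - \<phi> $ j)"
    "u \<in> subdifferential infnorm \<phi>"
    "\<And>x. (\<Sum>(i, j)\<in>E. z i j * (x $ i - x $ j)) / 2 = \<mu> * vol E * (u \<bullet> x)"
  note \<sigma> = sign_pattern_simps[OF eigenvector_nonzero]
  obtain s where s: "\<And>i. i \<notin> D_zero \<phi> \<Longrightarrow> x $ i = s * sign_pattern \<phi> $ i"
    and const: "\<And>i j. \<lbrakk>(i, j) \<in> E; i \<in> D_zero \<phi>; j \<in> D_zero \<phi>\<rbrakk> \<Longrightarrow> x $ i = x $ j"
    using x unfolding interior_subspace_def by blast
  note D = D_disjoint[OF eigenvector_nonzero]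
  have plus: "x $ i = s" if "i \<in> D_plus \<phi>" for i
    using s[of i] that D \<sigma>(1) by auto
  have minus: "x $ i = - s" if "i \<in> D_minus \<phi>" for i
    using s[of i] that D \<sigma>(2) by auto
  define c where "c = (\<chi> i. if i \<in> D_zero \<phi> then (\<bar>x $ i + s\<bar> - \<bar>x $ i - s\<bar>) / 2 else 0)"
  have c_zero: "c $ i = (\<bar>x $ i + s\<bar> - \<bar>x $ i - s\<bar>) / 2" if "i \<in> D_zero \<phi>" for i
    using that by (simp add: c_def)
  have c_other: "c $ i = 0" if "i \<in> D_plus \<phi> \<or> i \<in> D_minus \<phi>" for i
    using that D by (auto simp: c_def)
  have le: "\<bar>x $ i\<bar> \<le> infnorm x" for i
    by (rule component_le_infnorm_cart)
  have z_greater: "z i j = 1" if "(i, j) \<in> E" "\<phi> $ i > \<phi> $ j" for i j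
    using zu(1)[OF that(1)] that(2) by (simp add: Sgn_def)
  have z_less: "z i j = - 1" if "(i, j) \<in> E" "\<phi> $ i < \<phi> $ j" for i j
    using zu(1)[OF that(1)] that(2) by (simp add: Sgn_def)
  have less_plus: "\<phi> $ i < \<phi> $ j" if "i \<in> D_zero \<phi>" "j \<in> D_plus \<phi>" for i j
    using that by (simp add: D_zero_def D_plus_def abs_less_iff)
  have minus_less: "\<phi> $ j < \<phi> $ i" if "i \<in> D_zero \<phi>" "j \<in> D_minus \<phi>" for i j
    using that by (simp add: D_zero_def D_minus_def abs_less_iff)
  show ?thesis
  proof (rule total_variation_le_of_edgewise[OF eigenvector_nonzero zu, where c = c])
    show "c $ i = 0" if "i \<notin> D_zero \<phi>" for i
      using that by (simp add: c_def)
    fix i j assume ij: "(i, j) \<in> E"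
    show "\<bar>x $ i - x $ j\<bar> \<le> infnorm x * \<bar>sign_pattern \<phi> $ i - sign_pattern \<phi> $ j\<bar> + z i j * (c $ i - c $ j)"
      using D_trichotomy[of i \<phi>] D_trichotomy[of j \<phi>]
    proof (elim disjE)
      assume "i \<in> D_plus \<phi>" "j \<in> D_plus \<phi>"
      then show ?thesis by (simp add: \<sigma> plus c_other)
    next
      assume "i \<in> D_minus \<phi>" "j \<in> D_minus \<phi>"
      then show ?thesis by (simp add: \<sigma> minus c_other)
    next
      assume "i \<in> D_plus \<phi>" "j \<in> D_minus \<phi>"
      then show ?thesis using le[of i] by (simp add: \<sigma> plus minus c_other)
    next
      assume "i \<in> D_minus \<phi>" "j \<in> D_plus \<phi>"
      then show ?thesis using le[of j] by (simp add: \<sigma> plus minus c_other)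
    next
      assume "i \<in> D_zero \<phi>" "j \<in> D_zero \<phi>"
      then show ?thesis using const[OF ij] by (simp add: \<sigma> c_zero)
    next
      \<comment> \<open>On an edge between interior and boundary, \<phi> strictly separates the
        endpoints, so \<open>z\<close> is 1 or -1, with the sign that matches the
        correction.\<close>
      assume i: "i \<in> D_zero \<phi>" and j: "j \<in> D_plus \<phi>"
      show ?thesis
        using le[of i] le[of j] z_less[OF ij less_plus[OF i j]] c_other[of j] j
        unfolding \<sigma>(3)[OF i] \<sigma>(1)[OF j] plus[OF j] c_zero[OF i] by (simp add: abs_if split: if_splits)
    next
      assume i: "i \<in> D_zero \<phi>" and j: "j \<in> D_minus \<phi>"
      show ?thesis
        using le[of i] le[of j] z_greater[OF ij minus_less[OF i j]] c_other[of j] j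
        unfolding \<sigma>(3)[OF i] \<sigma>(2)[OF j] minus[OF j] c_zero[OF i] by (simp add: abs_if split: if_splits)
    next
      assume i: "i \<in> D_plus \<phi>" and j: "j \<in> D_zero \<phi>"
      show ?thesis
        using le[of i] le[of j] z_greater[OF ij less_plus[OF j i]] c_other[of i] i
        unfolding \<sigma>(3)[OF j] \<sigma>(1)[OF i] plus[OF i] c_zero[OF j] by (simp add: abs_if split: if_splits)
    next
      assume i: "i \<in> D_minus \<phi>" and j: "j \<in> D_zero \<phi>"
      show ?thesis
        using le[of i] le[of j] z_less[OF ij minus_less[OF j i]] c_other[of i] i
        unfolding \<sigma>(3)[OF j] \<sigma>(2)[OF i] minus[OF i] c_zero[OF j] by (simp add: abs_if split: if_splits)
    qed
  qed
qed

lemma sign_pattern_nonzero: "sign_pattern \<phi> \<noteq> 0"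
proof -
  obtain u where "u \<in> subdifferential infnorm \<phi>"
    using eigen by (auto simp: eigenpair_def)
  from subdifferential_infnorm(2)[OF eigenvector_nonzero this] show ?thesis
    by auto
qed

end

theorem theorem4p11:
  fixes E :: "'n::finite rel" and \<phi> :: "real ^ 'n" and k r :: nat
  assumes "simple_graph E" and "E \<noteq> {}"
    and "k \<in> {1..CARD('n)}"
    and "eigenpair E (minimax_value E k) \<phi>"
    and "r = multiplicity_at E k"
  shows "int (S_pm E \<phi>) \<le> int k + int r - 1 \<and> int (S_zero E \<phi>) \<le> int k + int r - 2"
proof -
  have sym: "sym E"
    using assms(1) by (simp add: simple_graph_def)
  note eig = sym assms(4)
  have "dim (extremal_subspace E \<phi>) + 1 \<le> k + r"
    unfolding assms(5)
    by (rule dim_le_of_total_variation_le[OF assms(2,3) subspace_extremal_subspace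
          total_variation_le_extremal_subspace[OF eig]])
  moreover have "dim (interior_subspace E \<phi>) + 1 \<le> k + r"
    unfolding assms(5)
    by (rule dim_le_of_total_variation_le[OF assms(2,3) subspace_interior_subspace
          total_variation_le_interior_subspace[OF eig]])
  ultimately show ?thesis
    using S_pm_le_dim[OF sym eigenvector_nonzero[OF eig]]
      S_zero_le_dim[OF sym eigenvector_nonzero[OF eig] sign_pattern_nonzero[OF eig]] by linarith
qed

end
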